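(* Let $d\ge3$, $\tau>0$, $\lambda>0$, and let $A:\mathbb{R}^d\to\mathbb{R}^d$, $V:\mathbb{R}^d\to\mathbb{R}$. Assume that $B_\tau\equiv0$ and that $$\int_{\mathbb{R}^d}\left[\partial_r(rV)+V\right]_-|v|^2\,dx<\int_{\mathbb{R}^d}\left[\partial_r(rV)+V\right]_+|v|^2\,dx$$ for every function $v$ on $\mathbb{R}^d$, not almost everywhere zero, for which both integrals are finite. Then for all $u\in C_0^\infty(\mathbb{R}^d)$ $$4\tau\lambda\int_{\mathbb{R}^d}|x|^{2\tau}|u|^2\,dx\le\int_{\mathbb{R}^d}|x|^{2\tau+2}\left|\nabla_A^2u+Vu+\lambda u\right|^2dx .$$
   Context: Notation: $r=|x|$, and $\partial_r=\frac{x}{|x|}\cdot\nabla$ is the radial derivative. $A:\mathbb{R}^d\to\mathbb{R}^d$ is the magnetic vector potential and $V:\mathbb{R}^d\to\mathbb{R}$ the electric potential. $\nabla_A:=\nabla+iA$, $\nabla_A^2=\nabla_A\cdot\nabla_A=\sum_j(\partial_{x_j}+iA_j)^2$. The magnetic field is the antisymmetric matrix with entries $B_{kj}=\frac{\partial A_k}{\partial x_j}-\frac{\partial A_j}{\partial x_k}$, and its tangential part $B_\tau$ is the vector field with components $(B_\tau)_j=\sum_{k=1}^d\frac{x_k}{|x|}B_{kj}$ (the subscript in $B_\tau$ is only a label, unrelated to the parameter $\tau$). For a real function $f$, $[f]_\pm\ge0$ denote its positive and negative parts, $f=[f]_+-[f]_-$. *)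

theory Defs
  imports "HOL-Analysis.Analysis"
begin

text \<open>
  Conventions. Integrals of nonnegative functions are Lebesgue integrals with values in
  \<^typ>\<open>ennreal\<close>, so that they may be infinite. Differential expressions are understood
  classically and are used only where the functions involved are differentiable. The
  potentials may be singular at the origin, where the radial derivative is not defined;
  since the origin is a null set, values there do not affect any of the integrals.
\<close>

definition partial :: "'n \<Rightarrow> (real ^ 'n::finite \<Rightarrow> 'b::real_normed_vector) \<Rightarrow> real ^ 'n \<Rightarrow> 'b"
  where "partial j f x = frechet_derivative f (at x) (axis j 1)"

definition radial_deriv :: "(real ^ 'n::finite \<Rightarrow> 'b::real_normed_vector) \<Rightarrow> real ^ 'n \<Rightarrow> 'b"
  where "radial_deriv f x = (\<Sum>j\<in>UNIV. (x $ j / norm x) *\<^sub>R partial j f x)"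

text \<open>\<open>Ck_on k S f\<close> is the property of being of class $C^k$; it is intended for open \<open>S\<close> only.\<close>

primrec Ck_on ::
    "nat \<Rightarrow> (real ^ 'n::finite) set \<Rightarrow> (real ^ 'n \<Rightarrow> 'b::real_normed_vector) \<Rightarrow> bool"
  where
    "Ck_on 0 S f \<longleftrightarrow> continuous_on S f"
  | "Ck_on (Suc k) S f \<longleftrightarrow> (\<forall>x\<in>S. f differentiable (at x)) \<and> (\<forall>j. Ck_on k S (partial j f))"

definition Cinf_compact_support :: "(real ^ 'n::finite \<Rightarrow> complex) \<Rightarrow> bool"
  where "Cinf_compact_support u \<longleftrightarrow>
    (\<forall>k. Ck_on k UNIV u) \<and> compact (closure {x. u x \<noteq> 0})"

definition cov_deriv ::
    "(real ^ 'n::finite \<Rightarrow> real ^ 'n) \<Rightarrow> 'n \<Rightarrow> (real ^ 'n \<Rightarrow> complex) \<Rightarrow> real ^ 'n \<Rightarrow> complex"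
  where "cov_deriv A j u x = partial j u x + \<i> * of_real (A x $ j) * u x"

definition magnetic_laplacian ::
    "(real ^ 'n::finite \<Rightarrow> real ^ 'n) \<Rightarrow> (real ^ 'n \<Rightarrow> complex) \<Rightarrow> real ^ 'n \<Rightarrow> complex"
  where "magnetic_laplacian A u x = (\<Sum>j\<in>UNIV. cov_deriv A j (cov_deriv A j u) x)"

definition magnetic_field ::
    "(real ^ 'n::finite \<Rightarrow> real ^ 'n) \<Rightarrow> 'n \<Rightarrow> 'n \<Rightarrow> real ^ 'n \<Rightarrow> real"
  where "magnetic_field A k j x = partial j (\<lambda>y. A y $ k) x - partial k (\<lambda>y. A y $ j) x"

definition B_tangential :: "(real ^ 'n::finite \<Rightarrow> real ^ 'n) \<Rightarrow> real ^ 'n \<Rightarrow> real ^ 'n"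
  where "B_tangential A x = (\<chi> j. \<Sum>k\<in>UNIV. x $ k / norm x * magnetic_field A k j x)"

definition pos_part :: "real \<Rightarrow> real"
  where "pos_part t = max t 0"

definition neg_part :: "real \<Rightarrow> real"
  where "neg_part t = max (- t) 0"

end

theory Submission
  imports Defs
begin

text \<open>
  Write \<open>r = |x|\<close>, let \<open>D = x \<cdot> \<nabla>\<^sub>A\<close> generate covariant dilations, and put
  \<open>w = r\<^sup>\<alpha> u\<close> with \<open>\<alpha> = \<tau> + (d - 2)/2\<close>. With respect to the dilation invariant measure
  \<open>r\<^sup>-\<^sup>d dx\<close>, the operator \<open>r\<^sup>2 (\<nabla>\<^sub>A\<^sup>2 + V + \<lambda>)\<close> becomes \<open>S - 2 \<tau> D\<close> with \<open>S\<close> symmetric and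
  \<open>D\<close> antisymmetric. Since \<open>B\<^sub>\<tau> = 0\<close>, the angular part of \<open>S\<close> commutes with \<open>D\<close>, and the
  commutator \<open>[S, D]\<close> only sees the potential: it is multiplication by
  \<open>- x \<cdot> \<nabla>(r\<^sup>2 V) - 2 \<lambda> r\<^sup>2\<close>. The second term gives the inequality and the first one has a
  favourable sign, because the hypothesis on \<open>V\<close> says that \<open>r\<^sup>2 V\<close> is nondecreasing along rays.

  As \<open>A\<close> and \<open>V\<close> may be arbitrarily singular at the origin, the computation is carried out with a
  radial cutoff \<open>\<theta>\<close>. Up to terms of good sign, the boundary terms with \<open>\<kappa> = x \<cdot> \<nabla>\<theta>\<close> are
  turned, by testing the equation against \<open>\<kappa> w\<close>, into terms which contain neither \<open>A\<close> nor \<open>V\<close>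
  except through the right-hand side; these vanish with the cutoff by dominated convergence, where
  a Hardy inequality provides the integrability of \<open>r\<^sup>2\<^sup>\<tau>\<^sup>-\<^sup>2 |u|\<^sup>2\<close>.
\<close>

subsection \<open>Calculus of class-one functions\<close>

text \<open>The choice of \<alpha> gives r^(2 \<alpha> - d) = r^(2 \<tau> - 2), so that the squared
  norm of the conjugated equation in the invariant measure is exactly the right-hand side of the
  claim.

  The obstacle is that nothing is known about the covariant gradient near the origin. Expanding the
  square under the cutoff leaves the boundary term -2 \<tau> \<kappa> r^2 |nabla_A w|^2, which has
  the wrong sign and cannot be shown to vanish. Subtracting 2 \<tau> \<kappa> times the equation
  paired with \<open>w\<close> produces the same energy with the opposite sign. The same coefficient
  2 \<tau> also completes the potential term to r^2 V times the full derivative of \<theta> |w|^2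
  along x, which is the form in which monotonicity of r^2 V can be exploited although its derivative
  need not be integrable. The price is the appearance of \<kappa>' and \<kappa>'', from rewriting
  the first-order terms of this pairing; hence the cutoff must be differentiable three times along
  x.

  No operator theory is involved: a pointwise identity writes the integrand as divergences, one
  monotone term and squares.\<close>

lemma partialI: "(f has_derivative f') (at x) \<Longrightarrow> partial j f x = f' (axis j 1)"
  by (simp add: partial_def frechet_derivative_at[symmetric])

declare One_nat_def [simp del] \<comment> \<open>keeps the simplifier from turning \<open>Ck_on 1\<close> into \<open>Ck_on (Suc 0)\<close>\<close>

lemma Ck_on_1_iff:
  "Ck_on 1 S f \<longleftrightarrow> (\<forall>x\<in>S. f differentiable (at x)) \<and> (\<forall>j. continuous_on S (partial j f))"
  by (simp add: One_nat_def)

lemma Ck_on_2_iff: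
  "Ck_on 2 S f \<longleftrightarrow> (\<forall>x\<in>S. f differentiable (at x)) \<and> (\<forall>j. Ck_on 1 S (partial j f))"
  by (simp add: numeral_2_eq_2 One_nat_def)

declare Ck_on.simps(2) [simp del]

lemmas differentiableD = frechet_derivative_works [THEN iffD1]

lemma Ck_on_differentiable: "Ck_on 1 S f \<Longrightarrow> x \<in> S \<Longrightarrow> f differentiable (at x)"
  unfolding Ck_on_1_iff by auto

lemma Ck_on_continuous: "Ck_on 1 S f \<Longrightarrow> continuous_on S f"
  unfolding Ck_on_1_iff
  by (intro continuous_at_imp_continuous_on) (auto simp: differentiable_imp_continuous_within)

lemma Ck_on_subset: "Ck_on k S f \<Longrightarrow> T \<subseteq> S \<Longrightarrow> Ck_on k T f"
  by (induction k arbitrary: f) (auto simp: Ck_on.simps(2) intro: continuous_on_subset)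

lemma Ck_on_2_imp_1:
  assumes "Ck_on 2 S w" shows "Ck_on 1 S w"
  using assms unfolding Ck_on_2_iff Ck_on_1_iff
  by (auto intro!: differentiable_imp_continuous_on simp: differentiable_on_def differentiable_at_withinI)

lemma partial_cong:
  assumes "open S" "x \<in> S" "\<And>y. y \<in> S \<Longrightarrow> f y = g y"
  shows "partial j f x = partial j g x"
proof -
  have "(f has_derivative D) (at x) = (g has_derivative D) (at x)" for D
    using has_derivative_transform_within_open[OF _ assms(1,2), of f D UNIV g]
      has_derivative_transform_within_open[OF _ assms(1,2), of g D UNIV f] assms(3) by auto
  then show ?thesis unfolding partial_def frechet_derivative_def by simp
qed

lemma Ck_on_1_cong:
  assumes "open S" "\<And>y. y \<in> S \<Longrightarrow> f y = g y" "Ck_on 1 S f"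
  shows "Ck_on 1 S g"
  unfolding Ck_on_1_iff
proof (intro conjI ballI allI)
  fix x assume "x \<in> S"
  then show "g differentiable (at x)"
    using has_derivative_transform_within_open[OF _ assms(1), of f _ x UNIV g] assms(2)
      Ck_on_differentiable[OF assms(3)] unfolding differentiable_def by blast
next
  fix j
  have "continuous_on S (partial j f)" using assms(3) unfolding Ck_on_1_iff by auto
  then show "continuous_on S (partial j g)"
    by (rule continuous_on_eq) (rule partial_cong[OF assms(1)], use assms(2) in auto)
qed

lemma partial_bilinear:
  assumes b: "bounded_bilinear p"
    and f: "f differentiable (at x)" and g: "g differentiable (at x)"
  shows "partial j (\<lambda>y. p (f y) (g y)) x = p (f x) (partial j g x) + p (partial j f x) (g x)"
proof -
  have "((\<lambda>y. p (f y) (g y)) has_derivative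
     (\<lambda>h. p (f x) (frechet_derivative g (at x) h) + p (frechet_derivative f (at x) h) (g x))) (at x)"
    by (rule bounded_bilinear.FDERIV[OF b differentiableD[OF f] differentiableD[OF g]])
  then show ?thesis by (simp add: partialI) (simp add: partial_def)
qed

lemma differentiable_bilinear:
  assumes b: "bounded_bilinear p"
    and f: "f differentiable (at x)" and g: "g differentiable (at x)"
  shows "(\<lambda>y. p (f y) (g y)) differentiable (at x)"
  using bounded_bilinear.FDERIV[OF b differentiableD[OF f] differentiableD[OF g]]
  unfolding differentiable_def by blast

lemma partial_linear:
  assumes b: "bounded_linear p" and f: "f differentiable (at x)"
  shows "partial j (\<lambda>y. p (f y)) x = p (partial j f x)"
proof -
  have "((\<lambda>y. p (f y)) has_derivative (\<lambda>h. p (frechet_derivative f (at x) h))) (at x)"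
    using bounded_linear.has_derivative[OF b] f frechet_derivative_works by blast
  then show ?thesis by (simp add: partialI) (simp add: partial_def)
qed

lemma differentiable_linear:
  assumes b: "bounded_linear p" and f: "f differentiable (at x)"
  shows "(\<lambda>y. p (f y)) differentiable (at x)"
  using bounded_linear.has_derivative[OF b] f unfolding differentiable_def by blast

lemma partial_add:
  assumes "f differentiable (at x)" "g differentiable (at x)"
  shows "partial j (\<lambda>y. f y + g y) x = partial j f x + partial j g x"
proof -
  have "((\<lambda>y. f y + g y) has_derivative
     (\<lambda>h. frechet_derivative f (at x) h + frechet_derivative g (at x) h)) (at x)"
    using assms frechet_derivative_works by (intro has_derivative_add) blast+
  then show ?thesis by (simp add: partialI) (simp add: partial_def)
qed

lemma partial_diff:
  assumes "f differentiable (at x)" "g differentiable (at x)"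
  shows "partial j (\<lambda>y. f y - g y) x = partial j f x - partial j g x"
proof -
  have "((\<lambda>y. f y - g y) has_derivative
     (\<lambda>h. frechet_derivative f (at x) h - frechet_derivative g (at x) h)) (at x)"
    using assms frechet_derivative_works by (intro has_derivative_diff) blast+
  then show ?thesis by (simp add: partialI) (simp add: partial_def)
qed

lemma partial_sum:
  assumes "finite I" "\<And>i. i \<in> I \<Longrightarrow> f i differentiable (at x)"
  shows "partial j (\<lambda>y. \<Sum>i\<in>I. f i y) x = (\<Sum>i\<in>I. partial j (f i) x)"
proof -
  have "((\<lambda>y. \<Sum>i\<in>I. f i y) has_derivative
     (\<lambda>h. \<Sum>i\<in>I. frechet_derivative (f i) (at x) h)) (at x)"
    using assms frechet_derivative_works by (intro has_derivative_sum) blast+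
  then show ?thesis by (simp add: partialI) (simp add: partial_def)
qed

lemma partial_const [simp]: "partial j (\<lambda>y. c) x = 0"
  using partialI[OF has_derivative_const] .

lemma partial_component: "partial j (\<lambda>y. y $ k) (x :: real ^ 'n::finite) = (if k = j then 1 else 0)"
proof -
  have "((\<lambda>y::real^'n. y $ k) has_derivative (\<lambda>y. y $ k)) (at x)"
    by (rule bounded_linear.has_derivative[OF bounded_linear_vec_nth has_derivative_ident])
  then show ?thesis by (simp add: partialI axis_def)
qed

lemma differentiable_component: "(\<lambda>y. y $ k) differentiable (at (x :: real ^ 'n::finite))"
  by (rule differentiable_linear[OF bounded_linear_vec_nth differentiable_ident])

lemma Ck_on_1_component: "Ck_on 1 S (\<lambda>y :: real ^ 'n::finite. y $ k)"
  unfolding Ck_on_1_iff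
  by (simp add: differentiable_component partial_component[abs_def])

lemma Ck_on_1_bilinear:
  assumes b: "bounded_bilinear p" and f: "Ck_on 1 S f" and g: "Ck_on 1 S g"
  shows "Ck_on 1 S (\<lambda>y. p (f y) (g y))"
  unfolding Ck_on_1_iff
proof (intro conjI ballI allI)
  fix x assume "x \<in> S"
  then show "(\<lambda>y. p (f y) (g y)) differentiable (at x)"
    by (intro differentiable_bilinear[OF b] Ck_on_differentiable[OF f] Ck_on_differentiable[OF g])
next
  fix j
  have "continuous_on S (\<lambda>x. p (f x) (partial j g x) + p (partial j f x) (g x))"
    using f g Ck_on_continuous[OF f] Ck_on_continuous[OF g]
    by (intro continuous_intros bounded_bilinear.continuous_on[OF b]) (auto simp: Ck_on_1_iff)
  then show "continuous_on S (partial j (\<lambda>y. p (f y) (g y)))"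
    by (rule continuous_on_eq)
       (simp add: partial_bilinear[OF b Ck_on_differentiable[OF f] Ck_on_differentiable[OF g]])
qed

lemmas Ck_on_1_mult = Ck_on_1_bilinear[OF bounded_bilinear_mult]
lemmas Ck_on_1_inner = Ck_on_1_bilinear[OF bounded_bilinear_inner]
lemmas Ck_on_1_scaleR = Ck_on_1_bilinear[OF bounded_bilinear_scaleR]

lemma Ck_on_1_linear:
  assumes b: "bounded_linear p" and f: "Ck_on 1 S f"
  shows "Ck_on 1 S (\<lambda>y. p (f y))"
  unfolding Ck_on_1_iff
proof (intro conjI ballI allI)
  fix x assume "x \<in> S"
  then show "(\<lambda>y. p (f y)) differentiable (at x)"
    by (intro differentiable_linear[OF b] Ck_on_differentiable[OF f])
next
  fix j
  have "continuous_on S (\<lambda>x. p (partial j f x))"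
    using f by (intro bounded_linear.continuous_on[OF b]) (auto simp: Ck_on_1_iff)
  then show "continuous_on S (partial j (\<lambda>y. p (f y)))"
    by (rule continuous_on_eq) (simp add: partial_linear[OF b Ck_on_differentiable[OF f]])
qed

lemma Ck_on_1_add:
  assumes f: "Ck_on 1 S f" and g: "Ck_on 1 S g"
  shows "Ck_on 1 S (\<lambda>y. f y + g y)"
  unfolding Ck_on_1_iff
proof (intro conjI ballI allI)
  fix j
  have "continuous_on S (\<lambda>x. partial j f x + partial j g x)"
    using f g by (intro continuous_intros) (auto simp: Ck_on_1_iff)
  then show "continuous_on S (partial j (\<lambda>y. f y + g y))"
    by (rule continuous_on_eq)
       (simp add: partial_add[OF Ck_on_differentiable[OF f] Ck_on_differentiable[OF g]])
qed (use assms Ck_on_differentiable in \<open>blast intro: differentiable_add\<close>)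

lemma Ck_on_1_diff:
  assumes f: "Ck_on 1 S f" and g: "Ck_on 1 S g"
  shows "Ck_on 1 S (\<lambda>y. f y - g y)"
proof -
  have "Ck_on 1 S (\<lambda>y. f y + (-1) *\<^sub>R g y)"
    by (intro Ck_on_1_add f Ck_on_1_linear[OF bounded_linear_scaleR_right g])
  then show ?thesis by simp
qed

lemma Ck_on_1_const: "Ck_on 1 S (\<lambda>y. c)"
  unfolding Ck_on_1_iff by (simp add: partial_const[abs_def])

lemma Ck_on_1_sum:
  assumes "finite I" "\<And>i. i \<in> I \<Longrightarrow> Ck_on 1 S (f i)"
  shows "Ck_on 1 S (\<lambda>y. \<Sum>i\<in>I. f i y)"
  using assms by (induction I rule: finite_induct) (auto intro: Ck_on_1_add Ck_on_1_const)

lemma partial_compose_real: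
  fixes f :: "real ^ 'n::finite \<Rightarrow> real"
  assumes f: "f differentiable (at x)" and g: "(g has_real_derivative g') (at (f x))"
  shows "partial j (\<lambda>y. g (f y)) x = g' * partial j f x"
    and "(\<lambda>y. g (f y)) differentiable (at x)"
proof -
  have "(g has_derivative (\<lambda>h. g' * h)) (at (f x))"
    using g by (simp add: has_field_derivative_def)
  then have *: "((\<lambda>y. g (f y)) has_derivative (\<lambda>h. g' * frechet_derivative f (at x) h)) (at x)"
    by (rule has_derivative_compose[OF differentiableD[OF f]])
  then show "partial j (\<lambda>y. g (f y)) x = g' * partial j f x"
    by (simp add: partialI) (simp add: partial_def)
  show "(\<lambda>y. g (f y)) differentiable (at x)" using * differentiable_def by blast
qed

lemma partial_norm:
  fixes x :: "real ^ 'n::finite"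
  assumes "x \<noteq> 0"
  shows "partial j norm x = x $ j / norm x"
    and "(norm :: real ^ 'n \<Rightarrow> real) differentiable (at x)"
proof -
  have *: "((norm :: real ^ 'n \<Rightarrow> real) has_derivative (\<lambda>h. h \<bullet> sgn x)) (at x)"
    using has_derivative_norm[OF assms] by (simp add: inner_commute)
  then show "partial j norm x = x $ j / norm x"
    by (simp add: partialI inner_axis' sgn_div_norm divide_inverse)
  show "(norm :: real ^ 'n \<Rightarrow> real) differentiable (at x)" using * differentiable_def by blast
qed

lemma derivative_along_line:
  fixes f :: "real ^ 'n::finite \<Rightarrow> real"
  assumes "f differentiable (at (x + t *\<^sub>R v))"
  shows "((\<lambda>s. f (x + s *\<^sub>R v)) has_real_derivative frechet_derivative f (at (x + t *\<^sub>R v)) v) (at t)"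
proof -
  let ?f' = "frechet_derivative f (at (x + t *\<^sub>R v))"
  have "((\<lambda>s. x + s *\<^sub>R v) has_derivative (\<lambda>h. h *\<^sub>R v)) (at t)"
    by (auto intro!: derivative_eq_intros)
  from has_derivative_compose[OF this differentiableD[OF assms]]
  have "((\<lambda>s. f (x + s *\<^sub>R v)) has_derivative (\<lambda>h. ?f' (h *\<^sub>R v))) (at t)" .
  moreover have "?f' (h *\<^sub>R v) = ?f' v * h" for h
    using linear_frechet_derivative[OF assms] by (simp add: linear_cmul)
  ultimately show ?thesis by (simp add: has_field_derivative_def)
qed

lemmas derivative_along_axis = derivative_along_line[where v = "axis j 1" for j, folded partial_def]

lemma derivative_as_sum_partial:
  fixes f :: "real ^ 'n::finite \<Rightarrow> 'b::real_normed_vector"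
  assumes "f differentiable (at x)"
  shows "frechet_derivative f (at x) h = (\<Sum>j\<in>UNIV. h $ j *\<^sub>R partial j f x)"
proof -
  have l: "linear (frechet_derivative f (at x))" by (rule linear_frechet_derivative[OF assms])
  have "frechet_derivative f (at x) h = frechet_derivative f (at x) (\<Sum>j\<in>UNIV. h $ j *\<^sub>R axis j 1)"
    using basis_expansion[of h] by (simp add: scalar_mult_eq_scaleR)
  also have "\<dots> = (\<Sum>j\<in>UNIV. h $ j *\<^sub>R partial j f x)"
    unfolding partial_def using l by (simp add: linear_sum linear_cmul)
  finally show ?thesis .
qed

section \<open>Symmetry of second partial derivatives\<close>

lemma mixed_difference:
  fixes f :: "real ^ 'n::finite \<Rightarrow> real"
  assumes h: "h > 0"
    and sub: "\<And>s t. 0 \<le> s \<Longrightarrow> s \<le> h \<Longrightarrow> 0 \<le> t \<Longrightarrow> t \<le> h \<Longrightarrow> x + s *\<^sub>R axis j 1 + t *\<^sub>R axis k 1 \<in> S"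
    and f: "\<And>y. y \<in> S \<Longrightarrow> f differentiable (at y)"
    and fj: "\<And>y. y \<in> S \<Longrightarrow> partial j f differentiable (at y)"
  obtains s t where "0 < s" "s < h" "0 < t" "t < h"
    "f (x + h *\<^sub>R axis j 1 + h *\<^sub>R axis k 1) - f (x + h *\<^sub>R axis j 1) - f (x + h *\<^sub>R axis k 1) + f x
      = h * h * partial k (partial j f) (x + s *\<^sub>R axis j 1 + t *\<^sub>R axis k 1)"
proof -
  define g where "g s = f ((x + h *\<^sub>R axis k 1) + s *\<^sub>R axis j 1) - f (x + s *\<^sub>R axis j 1)" for s
  let ?g' = "\<lambda>s. partial j f ((x + h *\<^sub>R axis k 1) + s *\<^sub>R axis j 1) - partial j f (x + s *\<^sub>R axis j 1)"
  have "\<exists>s>0. s < h \<and> g h - g 0 = (h - 0) * ?g' s"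
  proof (rule MVT2[OF h])
    fix s assume s: "0 \<le> s" "s \<le> h"
    have "x + s *\<^sub>R axis j 1 + h *\<^sub>R axis k 1 \<in> S" "x + s *\<^sub>R axis j 1 + 0 *\<^sub>R axis k 1 \<in> S"
      using sub[OF s, of h] sub[OF s, of 0] h by auto
    then show "DERIV g s :> ?g' s"
      unfolding g_def
      by (intro DERIV_diff derivative_along_axis f) (simp_all add: algebra_simps)
  qed
  then obtain s where s: "0 < s" "s < h" "g h - g 0 = h * ?g' s" by auto
  let ?y = "x + s *\<^sub>R axis j 1"
  have "\<exists>t>0. t < h \<and> partial j f (?y + h *\<^sub>R axis k 1) - partial j f (?y + 0 *\<^sub>R axis k 1)
     = (h - 0) * partial k (partial j f) (?y + t *\<^sub>R axis k 1)"
    using s by (intro MVT2[OF h] derivative_along_axis fj sub) auto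
  then obtain t where t: "0 < t" "t < h"
    "partial j f (?y + h *\<^sub>R axis k 1) - partial j f ?y = h * partial k (partial j f) (?y + t *\<^sub>R axis k 1)"
    by auto
  show ?thesis
  proof (rule that[OF s(1,2) t(1,2)])
    show "f (x + h *\<^sub>R axis j 1 + h *\<^sub>R axis k 1) - f (x + h *\<^sub>R axis j 1) - f (x + h *\<^sub>R axis k 1) + f x
      = h * h * partial k (partial j f) (?y + t *\<^sub>R axis k 1)"
      using s(3) t(3) by (simp add: g_def algebra_simps)
  qed
qed

text \<open>The second difference over a small square does not depend on the order of the two axes,
  while the mean value theorem identifies it with the area times either mixed derivative at a nearby
  point. Continuity of both derivatives then forces equality at \<open>x\<close>.\<close>

lemma partial_commute_real:
  fixes f :: "real ^ 'n::finite \<Rightarrow> real"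
  assumes S: "open S" "x \<in> S" and f: "Ck_on 2 S f"
  shows "partial j (partial k f) x = partial k (partial j f) x"
proof (rule ccontr)
  let ?F = "partial j (partial k f)" and ?G = "partial k (partial j f)"
  assume ne: "?F x \<noteq> ?G x"
  define e where "e = dist (?F x) (?G x) / 2"
  have e: "e > 0" using ne by (simp add: e_def)
  have d: "\<And>y. y \<in> S \<Longrightarrow> f differentiable (at y)"
      "\<And>i y. y \<in> S \<Longrightarrow> partial i f differentiable (at y)"
      "\<And>i l. continuous_on S (partial i (partial l f))"
    using f by (auto simp: Ck_on_2_iff Ck_on_1_iff)
  have "isCont ?F x" "isCont ?G x"
    using d(3) S continuous_on_eq_continuous_at by blast+
  then obtain d1 d2 where d1: "d1 > 0" "\<And>y. dist y x < d1 \<Longrightarrow> dist (?F y) (?F x) < e"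
    and d2: "d2 > 0" "\<And>y. dist y x < d2 \<Longrightarrow> dist (?G y) (?G x) < e"
    using e unfolding continuous_at_eps_delta by metis
  obtain d3 where d3: "d3 > 0" "ball x d3 \<subseteq> S" using S open_contains_ball by blast
  \<comment> \<open>Two displacements of length at most \<open>h\<close> move a point by at most
    \<open>2 * h\<close>; dividing by 4 keeps this strictly below all three radii.\<close>
  define h where "h = min d1 (min d2 d3) / 4"
  have h: "h > 0" "2 * h < d1" "2 * h < d2" "2 * h < d3" using d1 d2 d3 by (auto simp: h_def)
  have near: "dist (x + s *\<^sub>R axis i 1 + t *\<^sub>R axis l 1) x \<le> 2 * h"
    if "0 \<le> s" "s \<le> h" "0 \<le> t" "t \<le> h" for s t i l
  proof -
    have "norm (s *\<^sub>R axis i 1 + t *\<^sub>R (axis l 1 :: real ^ 'n)) \<le> s + t"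
      using norm_triangle_ineq[of "s *\<^sub>R axis i (1::real)" "t *\<^sub>R axis l 1"] that by simp
    then show ?thesis using that by (simp add: dist_norm add.assoc)
  qed
  have sub: "x + s *\<^sub>R axis i 1 + t *\<^sub>R axis l 1 \<in> S"
    if "0 \<le> s" "s \<le> h" "0 \<le> t" "t \<le> h" for s t i l
    using near[OF that, of i l] h d3 by (auto simp: dist_commute)
  obtain s t where st: "0 < s" "s < h" "0 < t" "t < h"
    "f (x + h *\<^sub>R axis j 1 + h *\<^sub>R axis k 1) - f (x + h *\<^sub>R axis j 1) - f (x + h *\<^sub>R axis k 1) + f x
      = h * h * ?G (x + s *\<^sub>R axis j 1 + t *\<^sub>R axis k 1)"
    by (rule mixed_difference[OF h(1), of x j k S f]) (assumption | rule sub d that)+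
  obtain s' t' where st': "0 < s'" "s' < h" "0 < t'" "t' < h"
    "f (x + h *\<^sub>R axis k 1 + h *\<^sub>R axis j 1) - f (x + h *\<^sub>R axis k 1) - f (x + h *\<^sub>R axis j 1) + f x
      = h * h * ?F (x + s' *\<^sub>R axis k 1 + t' *\<^sub>R axis j 1)"
    by (rule mixed_difference[OF h(1), of x k j S f]) (assumption | rule sub d that)+
  let ?p = "x + s *\<^sub>R axis j 1 + t *\<^sub>R axis k 1" and ?p' = "x + s' *\<^sub>R axis k 1 + t' *\<^sub>R axis j 1"
  have "x + h *\<^sub>R axis k 1 + h *\<^sub>R axis j 1 = x + h *\<^sub>R axis j 1 + h *\<^sub>R axis k 1"
    by (simp add: add_ac)
  then have "h * h * ?G ?p = h * h * ?F ?p'" using st(5) st'(5) by (simp only:)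
  then have eq: "?G ?p = ?F ?p'" using h by simp
  have "dist (?F ?p') (?F x) < e" "dist (?G ?p) (?G x) < e"
    using near[of s t j k] near[of s' t' k j] st st' h by (auto intro!: d1 d2)
  then have "dist (?F x) (?G x) < e + e"
    using eq dist_triangle[of "?F x" "?G x" "?F ?p'"] by (simp add: dist_commute)
  then show False by (simp add: e_def)
qed

lemma Ck_on_2_linear:
  assumes b: "bounded_linear p" and f: "Ck_on 2 S f" and S: "open S"
  shows "Ck_on 2 S (\<lambda>y. p (f y))"
  unfolding Ck_on_2_iff
proof (intro conjI ballI allI)
  fix x assume "x \<in> S"
  then show "(\<lambda>y. p (f y)) differentiable (at x)"
    using f by (intro differentiable_linear[OF b]) (auto simp: Ck_on_2_iff)
next
  fix j
  have *: "Ck_on 1 S (\<lambda>y. p (partial j f y))"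
    using f by (intro Ck_on_1_linear[OF b]) (auto simp: Ck_on_2_iff)
  show "Ck_on 1 S (partial j (\<lambda>y. p (f y)))"
    by (rule Ck_on_1_cong[OF S _ *]) (use f in \<open>simp add: Ck_on_2_iff partial_linear[OF b]\<close>)
qed

text \<open>The mean value theorem fails for complex values, so the real and imaginary parts are
  treated separately.\<close>

lemma partial_commute:
  fixes f :: "real ^ 'n::finite \<Rightarrow> complex"
  assumes S: "open S" "x \<in> S" and f: "Ck_on 2 S f"
  shows "partial j (partial k f) x = partial k (partial j f) x"
proof -
  have *: "p (partial j (partial k f) x) = partial j (partial k (\<lambda>y. p (f y))) x"
    if b: "bounded_linear p" for p :: "complex \<Rightarrow> real" and j k
  proof -
    have "partial j (partial k (\<lambda>y. p (f y))) x = partial j (\<lambda>y. p (partial k f y)) x"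
      using f by (intro partial_cong[OF S]) (auto simp: Ck_on_2_iff partial_linear[OF b])
    also have "\<dots> = p (partial j (partial k f) x)"
      using f S by (intro partial_linear[OF b] Ck_on_differentiable) (auto simp: Ck_on_2_iff)
    finally show ?thesis ..
  qed
  have "p (partial j (partial k f) x) = p (partial k (partial j f) x)"
    if b: "bounded_linear p" for p :: "complex \<Rightarrow> real"
    unfolding *[OF b] using partial_commute_real[OF S Ck_on_2_linear[OF b f S(1)]] .
  from this[OF bounded_linear_Re] this[OF bounded_linear_Im] show ?thesis
    by (simp add: complex_eq_iff)
qed

subsection \<open>Radial weights\<close>

text \<open>The second function is $x\cdot\nabla$ of the first one.\<close>

definition radial_weight :: "(real ^ 'n::finite \<Rightarrow> real) \<Rightarrow> (real ^ 'n \<Rightarrow> real) \<Rightarrow> bool"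
  where "radial_weight f f' \<longleftrightarrow> Ck_on 1 (- {0}) f \<and>
    (\<forall>x j. x \<noteq> 0 \<longrightarrow> partial j f x = x $ j / (norm x)\<^sup>2 * f' x)"

lemma open_punctured: "open (- {0 :: real ^ 'n::finite})"
  by (simp add: open_Compl)

lemma radial_weightD:
  assumes "radial_weight f f'"
  shows "Ck_on 1 (- {0}) f"
    and "x \<noteq> 0 \<Longrightarrow> f differentiable (at x)"
    and "x \<noteq> 0 \<Longrightarrow> partial j f x = x $ j / (norm x)\<^sup>2 * f' x"
  using assms Ck_on_differentiable[of "- {0}" f x] unfolding radial_weight_def by auto

lemma radial_weight_mult:
  fixes f f' g g' :: "real ^ 'n::finite \<Rightarrow> real"
  assumes f: "radial_weight f f'" and g: "radial_weight g g'"
  shows "radial_weight (\<lambda>x. f x * g x) (\<lambda>x. f x * g' x + f' x * g x)"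
  unfolding radial_weight_def
proof (intro conjI allI impI)
  show "Ck_on 1 (- {0}) (\<lambda>x. f x * g x)" by (intro Ck_on_1_mult radial_weightD(1)[OF f] radial_weightD(1)[OF g])
  fix x :: "real ^ 'n" and j assume "x \<noteq> 0"
  then show "partial j (\<lambda>x. f x * g x) x = x $ j / (norm x)\<^sup>2 * (f x * g' x + f' x * g x)"
    using partial_bilinear[OF bounded_bilinear_mult radial_weightD(2)[OF f] radial_weightD(2)[OF g]]
      radial_weightD(3)[OF f, of x j] radial_weightD(3)[OF g, of x j]
    by (simp add: distrib_left add_divide_distrib mult_ac)
qed

lemma radial_weight_add:
  fixes f f' g g' :: "real ^ 'n::finite \<Rightarrow> real"
  assumes f: "radial_weight f f'" and g: "radial_weight g g'"
  shows "radial_weight (\<lambda>x. f x + g x) (\<lambda>x. f' x + g' x)"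
  unfolding radial_weight_def
proof (intro conjI allI impI)
  show "Ck_on 1 (- {0}) (\<lambda>x. f x + g x)" by (intro Ck_on_1_add radial_weightD(1)[OF f] radial_weightD(1)[OF g])
  fix x :: "real ^ 'n" and j assume "x \<noteq> 0"
  then show "partial j (\<lambda>x. f x + g x) x = x $ j / (norm x)\<^sup>2 * (f' x + g' x)"
    using partial_add[OF radial_weightD(2)[OF f] radial_weightD(2)[OF g]]
      radial_weightD(3)[OF f, of x j] radial_weightD(3)[OF g, of x j]
    by (simp add: distrib_left add_divide_distrib mult_ac)
qed

lemma radial_weight_const: "radial_weight (\<lambda>x. c) (\<lambda>x. 0)"
  unfolding radial_weight_def by (simp add: Ck_on_1_const)

lemma radial_weight_cmult:
  assumes "radial_weight f f'"
  shows "radial_weight (\<lambda>x. c * f x) (\<lambda>x. c * f' x)"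
  using radial_weight_mult[OF radial_weight_const[of c] assms] by simp

lemma radial_weight_cong:
  fixes f f' g g' :: "real ^ 'n::finite \<Rightarrow> real"
  assumes "radial_weight f f'" "\<And>x. x \<noteq> 0 \<Longrightarrow> f x = g x" "\<And>x. x \<noteq> 0 \<Longrightarrow> f' x = g' x"
  shows "radial_weight g g'"
proof -
  have "partial j g x = partial j f x" if "x \<noteq> 0" for x j
    using that assms(2) by (intro partial_cong[OF open_punctured]) auto
  then show ?thesis
    using assms Ck_on_1_cong[OF open_punctured, of f g] unfolding radial_weight_def by auto
qed

lemma radial_weight_norm:
  fixes g g' :: "real \<Rightarrow> real"
  assumes g: "\<And>r. r > 0 \<Longrightarrow> (g has_real_derivative g' r) (at r)" and g': "continuous_on {0<..} g'"
  shows "radial_weight (\<lambda>x :: real ^ 'n::finite. g (norm x)) (\<lambda>x. norm x * g' (norm x))"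
proof -
  have d: "(\<lambda>x :: real ^ 'n. g (norm x)) differentiable (at x)"
      "partial j (\<lambda>x :: real ^ 'n. g (norm x)) x = g' (norm x) * (x $ j / norm x)" if "x \<noteq> 0" for x j
    using partial_compose_real(1)[OF partial_norm(2)[OF that] g, of j]
      partial_compose_real(2)[OF partial_norm(2)[OF that] g] partial_norm(1)[OF that, of j] that by simp_all
  have c: "continuous_on (- {0}) (\<lambda>x :: real ^ 'n. g' (norm x) * (x $ j / norm x))" for j
    by (intro continuous_intros continuous_on_compose2[OF g']) auto
  have "continuous_on (- {0}) (partial j (\<lambda>x :: real ^ 'n. g (norm x)))" for j
    by (rule continuous_on_eq[OF c[of j]]) (simp add: d)
  then show ?thesis
    unfolding radial_weight_def Ck_on_1_iff using d by (auto simp: power2_eq_square)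
qed

lemma radial_weight_powr: "radial_weight (\<lambda>x. norm x powr a) (\<lambda>x. a * norm x powr a)"
proof -
  have "radial_weight (\<lambda>x. norm x powr a) (\<lambda>x. norm x * (a * norm x powr (a - 1)))"
  proof (rule radial_weight_norm)
    show "((\<lambda>r. r powr a) has_real_derivative a * r powr (a - 1)) (at r)" if "r > 0" for r :: real
      using that by (auto intro!: derivative_eq_intros)
    show "continuous_on {0<..} (\<lambda>r. a * r powr (a - 1))"
      by (intro continuous_intros) auto
  qed
  then show ?thesis
    by (rule radial_weight_cong) (auto simp: powr_diff field_simps)
qed

subsection \<open>Covariant differentiation\<close>

definition dilation ::
    "(real ^ 'n::finite \<Rightarrow> real ^ 'n) \<Rightarrow> (real ^ 'n \<Rightarrow> complex) \<Rightarrow> real ^ 'n \<Rightarrow> complex"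
  where "dilation A u x = (\<Sum>k\<in>UNIV. x $ k *\<^sub>R cov_deriv A k u x)"

text \<open>The potential cancels because multiplication by an imaginary number is antisymmetric for
  the real inner product Re (z * cnj w) on the complex numbers.\<close>

lemma cov_leibniz:
  assumes "f differentiable (at x)" "g differentiable (at x)"
  shows "partial j (\<lambda>y. f y \<bullet> g y) x = cov_deriv A j f x \<bullet> g x + f x \<bullet> cov_deriv A j g x"
  unfolding partial_bilinear[OF bounded_bilinear_inner assms] cov_deriv_def
  by (simp add: inner_complex_def algebra_simps)

lemma cov_scaleR:
  assumes "\<phi> differentiable (at x)" "f differentiable (at x)"
  shows "cov_deriv A j (\<lambda>y. \<phi> y *\<^sub>R f y) x = \<phi> x *\<^sub>R cov_deriv A j f x + partial j \<phi> x *\<^sub>R f x"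
  unfolding partial_bilinear[OF bounded_bilinear_scaleR assms] cov_deriv_def
  by (simp add: scaleR_conv_of_real algebra_simps)

lemma cov_add:
  assumes "f differentiable (at x)" "g differentiable (at x)"
  shows "cov_deriv A j (\<lambda>y. f y + g y) x = cov_deriv A j f x + cov_deriv A j g x"
  by (simp add: partial_add[OF assms] cov_deriv_def algebra_simps)

lemma cov_sum:
  assumes "finite I" "\<And>i. i \<in> I \<Longrightarrow> f i differentiable (at x)"
  shows "cov_deriv A j (\<lambda>y. \<Sum>i\<in>I. f i y) x = (\<Sum>i\<in>I. cov_deriv A j (f i) x)"
  by (simp add: partial_sum[OF assms] cov_deriv_def sum.distrib sum_distrib_left)

lemma cov_cong:
  assumes "open S" "x \<in> S" "\<And>y. y \<in> S \<Longrightarrow> f y = g y"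
  shows "cov_deriv A j f x = cov_deriv A j g x"
  unfolding cov_deriv_def using partial_cong[OF assms] assms by simp

locale transversal_field =
  fixes A :: "real ^ 'n::finite \<Rightarrow> real ^ 'n"
  assumes A_Ck: "Ck_on 1 (- {0}) A"
    and B_zero: "x \<noteq> 0 \<Longrightarrow> B_tangential A x = 0"
begin

abbreviation "E \<equiv> cov_deriv A"
abbreviation "D \<equiv> dilation A"

lemma A_component: "Ck_on 1 (- {0}) (\<lambda>y. A y $ j)"
  by (rule Ck_on_1_linear[OF bounded_linear_vec_nth A_Ck])

lemma Ck_on_cov:
  assumes w: "Ck_on 2 (- {0}) w"
  shows "Ck_on 1 (- {0}) (E j w)"
proof -
  note w1 = Ck_on_2_imp_1[OF w]
  have b: "bounded_linear (\<lambda>a. \<i> * complex_of_real a)"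
    by (intro bounded_linear_mult_right[THEN bounded_linear_compose] bounded_linear_of_real)
  have "Ck_on 1 (- {0}) (\<lambda>y. partial j w y + (\<i> * complex_of_real (A y $ j)) * w y)"
    using w by (intro Ck_on_1_add Ck_on_1_mult w1 Ck_on_1_linear[OF b A_component]) (simp add: Ck_on_2_iff)
  then show ?thesis by (simp add: cov_deriv_def[abs_def])
qed

lemma Ck_on_dilation:
  assumes w: "Ck_on 2 (- {0}) w"
  shows "Ck_on 1 (- {0}) (D w)"
  unfolding dilation_def[abs_def]
  by (intro Ck_on_1_sum finite Ck_on_1_scaleR Ck_on_1_component Ck_on_cov w)

text \<open>The magnetic field is the curvature of the connection: second derivatives of
  \<open>w\<close> cancel by symmetry, and only the derivatives falling on \<open>A\<close> survive
  the commutator.\<close>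

lemma cov_commute:
  assumes w: "Ck_on 2 (- {0}) w" and x: "x \<noteq> 0"
  shows "E j (E k w) x = E k (E j w) x + \<i> * of_real (magnetic_field A k j x) * w x"
proof -
  have d: "w differentiable (at x)" "\<And>l. partial l w differentiable (at x)"
      "\<And>l. (\<lambda>y. A y $ l) differentiable (at x)"
    using w x Ck_on_differentiable[OF A_component] by (auto simp: Ck_on_2_iff intro!: Ck_on_differentiable)
  have b: "bounded_linear (\<lambda>a. \<i> * complex_of_real a)"
    by (intro bounded_linear_mult_right[THEN bounded_linear_compose] bounded_linear_of_real)
  note m = differentiable_bilinear[OF bounded_bilinear_mult differentiable_linear[OF b d(3)] d(1)]
  have *: "E j (E k w) x = partial j (partial k w) x + (\<i> * of_real (A x $ k)) * partial j w x
      + \<i> * of_real (partial j (\<lambda>y. A y $ k) x) * w x + \<i> * of_real (A x $ j) * E k w x" for j k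
  proof -
    have "partial j (E k w) x = partial j (partial k w) x + partial j (\<lambda>y. (\<i> * of_real (A y $ k)) * w y) x"
      unfolding cov_deriv_def[abs_def] by (rule partial_add[OF d(2) m])
    also have "partial j (\<lambda>y. (\<i> * of_real (A y $ k)) * w y) x
        = (\<i> * of_real (A x $ k)) * partial j w x + \<i> * of_real (partial j (\<lambda>y. A y $ k) x) * w x"
      by (subst partial_bilinear[OF bounded_bilinear_mult differentiable_linear[OF b d(3)] d(1)])
         (simp add: partial_linear[OF b d(3)])
    finally show ?thesis unfolding cov_deriv_def[of A j "E k w"] by (simp add: add_ac)
  qed
  have "partial j (partial k w) x = partial k (partial j w) x"
    using x by (intro partial_commute[OF open_punctured _ w]) auto
  then show ?thesis
    unfolding * magnetic_field_def by (simp add: cov_deriv_def algebra_simps)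
qed

text \<open>
  Vanishing of the tangential field is exactly what makes dilations commute with covariant
  derivatives as in the free case.
\<close>

lemma cov_dilation:
  assumes w: "Ck_on 2 (- {0}) w" and x: "x \<noteq> 0"
  shows "E j (D w) x = E j w x + (\<Sum>k\<in>UNIV. x $ k *\<^sub>R E k (E j w) x)"
proof -
  have d: "\<And>l. E l w differentiable (at x)"
    using x by (auto intro!: Ck_on_differentiable Ck_on_cov w)
  have s: "(\<lambda>y. y $ k *\<^sub>R E k w y) differentiable (at x)" for k
    by (rule differentiable_bilinear[OF bounded_bilinear_scaleR differentiable_component d])
  have "(\<Sum>k\<in>UNIV. x $ k * magnetic_field A k j x) = norm x * (B_tangential A x $ j)"
    using x by (simp add: B_tangential_def sum_distrib_left)
  then have B: "(\<Sum>k\<in>UNIV. x $ k * magnetic_field A k j x) = 0"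
    using B_zero[OF x] by simp
  have "E j (D w) x = (\<Sum>k\<in>UNIV. E j (\<lambda>y. y $ k *\<^sub>R E k w y) x)"
    unfolding dilation_def[abs_def] by (rule cov_sum) (auto intro: s)
  also have "\<dots> = (\<Sum>k\<in>UNIV. x $ k *\<^sub>R E j (E k w) x + (if k = j then 1 else 0) *\<^sub>R E k w x)"
    by (intro sum.cong) (auto simp: cov_scaleR[OF differentiable_component d] partial_component)
  also have "\<dots> = (\<Sum>k\<in>UNIV. x $ k *\<^sub>R E k (E j w) x) + E j w x
     + (\<Sum>k\<in>UNIV. \<i> * of_real (x $ k * magnetic_field A k j x) * w x)"
  proof -
    have *: "x $ k *\<^sub>R E j (E k w) x + (if k = j then 1 else 0) *\<^sub>R E k w x
      = x $ k *\<^sub>R E k (E j w) x + (if k = j then E k w x else 0)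
        + \<i> * of_real (x $ k * magnetic_field A k j x) * w x" for k
      unfolding cov_commute[OF w x, of j k] by (simp add: scaleR_conv_of_real algebra_simps)
    show ?thesis unfolding * sum.distrib by simp
  qed
  also have "(\<Sum>k\<in>UNIV. \<i> * of_real (x $ k * magnetic_field A k j x) * w x)
     = \<i> * of_real (\<Sum>k\<in>UNIV. x $ k * magnetic_field A k j x) * w x"
    by (simp add: sum_distrib_left sum_distrib_right)
  finally show ?thesis by (simp add: B)
qed

section \<open>Divergence identities of Rellich-Pohozaev type\<close>

definition energy :: "(real ^ 'n \<Rightarrow> complex) \<Rightarrow> real ^ 'n \<Rightarrow> real"
  where "energy w x = (\<Sum>k\<in>UNIV. E k w x \<bullet> E k w x)"

lemma Ck_on_energy: "Ck_on 2 (- {0}) w \<Longrightarrow> Ck_on 1 (- {0}) (energy w)"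
  unfolding energy_def[abs_def] by (intro Ck_on_1_sum finite Ck_on_1_inner Ck_on_cov)

text \<open>The flux is the one associated with dilations in the Rellich-Pohozaev identity. By
  \<open>cov_dilation\<close> the terms with second covariant derivatives form two double sums which
  agree after exchanging the indices. In the factor of the energy, 1 comes from the commutator of a
  covariant derivative with the dilation and d/2 from the divergence of x/2.\<close>

lemma divergence_dilation:
  fixes \<rho> \<rho>' :: "real ^ 'n \<Rightarrow> real"
  assumes w: "Ck_on 2 (- {0}) w" and \<rho>: "radial_weight \<rho> \<rho>'" and x: "x \<noteq> 0"
  shows "(\<Sum>j\<in>UNIV. partial j (\<lambda>y. \<rho> y * (E j w y \<bullet> D w y - (y $ j / 2) * energy w y)) x)
    = \<rho> x * (magnetic_laplacian A w x \<bullet> D w x + (1 - CARD('n) / 2) * energy w x)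
      + \<rho>' x * (D w x \<bullet> D w x / (norm x)\<^sup>2 - energy w x / 2)"
proof -
  have x': "x \<in> - {0}" using x by simp
  note dE = Ck_on_differentiable[OF Ck_on_cov[OF w] x']
  note dD = Ck_on_differentiable[OF Ck_on_dilation[OF w] x']
  note de = Ck_on_differentiable[OF Ck_on_energy[OF w] x']
  note d1 = differentiable_bilinear[OF bounded_bilinear_inner dE dD]
  have dc: "(\<lambda>y :: real ^ 'n. y $ j / 2) differentiable (at x)" for j
    by (rule differentiable_linear[OF bounded_linear_divide differentiable_component])
  note d2 = differentiable_bilinear[OF bounded_bilinear_mult dc de]
  have pe: "partial j (energy w) x = (\<Sum>k\<in>UNIV. 2 * (E k w x \<bullet> E j (E k w) x))" for j
    unfolding energy_def[abs_def]
    by (subst partial_sum)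
       (auto simp: cov_leibniz[OF dE dE, where A=A] inner_commute intro!: differentiable_bilinear[OF bounded_bilinear_inner dE dE])
  have p1: "partial j (\<lambda>y. E j w y \<bullet> D w y) x = E j (E j w) x \<bullet> D w x + E j w x \<bullet> E j w x
      + (\<Sum>k\<in>UNIV. x $ k * (E j w x \<bullet> E k (E j w) x))" for j
    by (simp add: cov_leibniz[OF dE dD, where A=A] cov_dilation[OF w x] inner_add_right inner_sum_right)
  have p2: "partial j (\<lambda>y. (y $ j / 2) * energy w y) x
      = energy w x / 2 + (\<Sum>k\<in>UNIV. x $ j * (E k w x \<bullet> E j (E k w) x))" for j
    unfolding partial_bilinear[OF bounded_bilinear_mult dc de]
    by (simp add: pe partial_component
        partial_linear[OF bounded_linear_divide differentiable_component] sum_distrib_left)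
  have "(\<Sum>j\<in>UNIV. partial j (\<lambda>y. \<rho> y * (E j w y \<bullet> D w y - (y $ j / 2) * energy w y)) x)
    = (\<Sum>j\<in>UNIV. \<rho> x * (partial j (\<lambda>y. E j w y \<bullet> D w y) x - partial j (\<lambda>y. (y $ j / 2) * energy w y) x)
       + (x $ j / (norm x)\<^sup>2 * \<rho>' x) * (E j w x \<bullet> D w x - (x $ j / 2) * energy w x))"
    unfolding partial_bilinear[OF bounded_bilinear_mult radial_weightD(2)[OF \<rho> x] differentiable_diff[OF d1 d2]]
      partial_diff[OF d1 d2] radial_weightD(3)[OF \<rho> x] ..
  also have "\<dots> = \<rho> x * ((\<Sum>j\<in>UNIV. partial j (\<lambda>y. E j w y \<bullet> D w y) x) - (\<Sum>j\<in>UNIV. partial j (\<lambda>y. (y $ j / 2) * energy w y) x))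
     + \<rho>' x / (norm x)\<^sup>2 * ((\<Sum>j\<in>UNIV. x $ j * (E j w x \<bullet> D w x)) - (\<Sum>j\<in>UNIV. x $ j * x $ j) * energy w x / 2)"
    by (simp add: sum.distrib sum_subtractf sum_distrib_left sum_distrib_right sum_divide_distrib algebra_simps)
  also have "(\<Sum>j\<in>UNIV. x $ j * (E j w x \<bullet> D w x)) = D w x \<bullet> D w x"
    by (simp add: dilation_def[of A w x] inner_sum_left)
  also have "(\<Sum>j\<in>UNIV. x $ j * x $ j) = (norm x)\<^sup>2"
    by (simp add: power2_norm_eq_inner inner_vec_def)
  also have "(\<Sum>j\<in>UNIV. partial j (\<lambda>y. E j w y \<bullet> D w y) x) - (\<Sum>j\<in>UNIV. partial j (\<lambda>y. (y $ j / 2) * energy w y) x)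
     = magnetic_laplacian A w x \<bullet> D w x + (1 - CARD('n) / 2) * energy w x"
  proof -
    have "(\<Sum>j\<in>UNIV. \<Sum>k\<in>UNIV. x $ k * (E j w x \<bullet> E k (E j w) x))
        = (\<Sum>j\<in>UNIV. \<Sum>k\<in>UNIV. x $ j * (E k w x \<bullet> E j (E k w) x))"
      by (rule sum.swap)
    then show ?thesis
      unfolding p1 p2 by (simp add: sum.distrib energy_def magnetic_laplacian_def inner_sum_left algebra_simps)
  qed
  also have "\<rho>' x / (norm x)\<^sup>2 * (D w x \<bullet> D w x - (norm x)\<^sup>2 * energy w x / 2)
     = \<rho>' x * (D w x \<bullet> D w x / (norm x)\<^sup>2 - energy w x / 2)"
    using x by (simp add: field_simps)
  finally show ?thesis .
qed

lemma divergence_energy: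
  fixes \<rho> \<rho>' :: "real ^ 'n \<Rightarrow> real"
  assumes w: "Ck_on 2 (- {0}) w" and \<rho>: "radial_weight \<rho> \<rho>'" and x: "x \<noteq> 0"
  shows "(\<Sum>j\<in>UNIV. partial j (\<lambda>y. \<rho> y * (E j w y \<bullet> w y)) x)
    = \<rho> x * (magnetic_laplacian A w x \<bullet> w x + energy w x) + \<rho>' x / (norm x)\<^sup>2 * (D w x \<bullet> w x)"
proof -
  have x': "x \<in> - {0}" using x by simp
  note dE = Ck_on_differentiable[OF Ck_on_cov[OF w] x']
  note dw = Ck_on_differentiable[OF Ck_on_2_imp_1[OF w] x']
  have "(\<Sum>j\<in>UNIV. partial j (\<lambda>y. \<rho> y * (E j w y \<bullet> w y)) x)
    = (\<Sum>j\<in>UNIV. \<rho> x * (E j (E j w) x \<bullet> w x + E j w x \<bullet> E j w x) + (x $ j / (norm x)\<^sup>2 * \<rho>' x) * (E j w x \<bullet> w x))"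
    by (intro sum.cong refl)
       (simp add: partial_bilinear[OF bounded_bilinear_mult radial_weightD(2)[OF \<rho> x] differentiable_bilinear[OF bounded_bilinear_inner dE dw]]
         cov_leibniz[OF dE dw, where A=A] radial_weightD(3)[OF \<rho> x])
  also have "\<dots> = \<rho> x * (magnetic_laplacian A w x \<bullet> w x + energy w x) + \<rho>' x / (norm x)\<^sup>2 * (D w x \<bullet> w x)"
    by (simp add: sum.distrib sum_distrib_left energy_def magnetic_laplacian_def dilation_def inner_sum_left algebra_simps)
  finally show ?thesis .
qed

lemma divergence_radial:
  fixes \<rho> \<rho>' :: "real ^ 'n \<Rightarrow> real"
  assumes w: "Ck_on 1 (- {0}) w" and \<rho>: "radial_weight \<rho> \<rho>'" and x: "x \<noteq> 0"
  shows "(\<Sum>j\<in>UNIV. partial j (\<lambda>y. \<rho> y * (y $ j * (w y \<bullet> w y))) x)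
    = (CARD('n) * \<rho> x + \<rho>' x) * (w x \<bullet> w x) + 2 * \<rho> x * (D w x \<bullet> w x)"
proof -
  have x': "x \<in> - {0}" using x by simp
  note dw = Ck_on_differentiable[OF w x']
  note dh = differentiable_bilinear[OF bounded_bilinear_inner dw dw]
  note dc = differentiable_bilinear[OF bounded_bilinear_mult differentiable_component dh]
  have "(\<Sum>j\<in>UNIV. partial j (\<lambda>y. \<rho> y * (y $ j * (w y \<bullet> w y))) x)
    = (\<Sum>j\<in>UNIV. \<rho> x * (x $ j * (2 * (E j w x \<bullet> w x)) + w x \<bullet> w x) + (x $ j / (norm x)\<^sup>2 * \<rho>' x) * (x $ j * (w x \<bullet> w x)))"
    by (intro sum.cong refl)
       (simp add: partial_bilinear[OF bounded_bilinear_mult radial_weightD(2)[OF \<rho> x] dc]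
         partial_bilinear[OF bounded_bilinear_mult differentiable_component dh] partial_component
         cov_leibniz[OF dw dw, where A=A] radial_weightD(3)[OF \<rho> x] inner_commute)
  also have "\<dots> = CARD('n) * \<rho> x * (w x \<bullet> w x) + 2 * \<rho> x * (D w x \<bullet> w x)
      + (\<Sum>j\<in>UNIV. x $ j * x $ j) * (\<rho>' x / (norm x)\<^sup>2 * (w x \<bullet> w x))"
    by (simp add: sum.distrib sum_distrib_left sum_distrib_right sum_divide_distrib dilation_def inner_sum_left algebra_simps)
  also have "(\<Sum>j\<in>UNIV. x $ j * x $ j) = (norm x)\<^sup>2"
    by (simp add: power2_norm_eq_inner inner_vec_def)
  finally show ?thesis using x by (simp add: algebra_simps)
qed

end

subsection \<open>Integration by parts\<close>

lemma difference_quotient_tendsto: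
  fixes f :: "real ^ 'n::finite \<Rightarrow> real"
  assumes f: "f differentiable (at x)"
  shows "(\<lambda>n. real (Suc n) * (f (x + inverse (real (Suc n)) *\<^sub>R v) - f x))
      \<longlonglongrightarrow> frechet_derivative f (at x) v"
proof -
  have "((\<lambda>s. f (x + s *\<^sub>R v)) has_real_derivative frechet_derivative f (at (x + 0 *\<^sub>R v)) v) (at 0)"
    by (rule derivative_along_line) (use f in simp)
  then have "((\<lambda>h. (f (x + h *\<^sub>R v) - f x) / h) \<longlongrightarrow> frechet_derivative f (at x) v) (at 0)"
    by (simp add: DERIV_def)
  moreover have "filterlim (\<lambda>n. inverse (real (Suc n))) (at 0) sequentially"
    by (rule filterlim_atI[OF LIMSEQ_inverse_real_of_nat]) auto
  ultimately have "(\<lambda>n. (f (x + inverse (real (Suc n)) *\<^sub>R v) - f x) / inverse (real (Suc n)))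
      \<longlonglongrightarrow> frechet_derivative f (at x) v"
    by (rule filterlim_compose)
  then show ?thesis by (simp add: divide_inverse mult.commute)
qed

text \<open>As the step never exceeds 1, the intermediate point stays within \<open>norm v\<close>
  of \<open>x\<close> for every \<open>n\<close>; this is what yields dominating functions for
  difference quotients.\<close>

lemma difference_quotient_mvt:
  fixes f :: "real ^ 'n::finite \<Rightarrow> real"
  assumes f: "\<And>x. f differentiable (at x)"
  obtains t where "0 < t" "t < 1" "real (Suc n) * (f (x + inverse (real (Suc n)) *\<^sub>R v) - f x)
      = frechet_derivative f (at (x + t *\<^sub>R v)) v"
proof -
  let ?h = "inverse (real (Suc n))"
  have h: "0 < ?h" "?h \<le> 1" by (auto simp: field_simps)
  obtain t where t: "0 < t" "t < ?h" "f (x + ?h *\<^sub>R v) - f (x + 0 *\<^sub>R v) = (?h - 0) * frechet_derivative f (at (x + t *\<^sub>R v)) v"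
    using MVT2[OF h(1) derivative_along_line[OF f]] by blast
  then have "real (Suc n) * (f (x + ?h *\<^sub>R v) - f x) = frechet_derivative f (at (x + t *\<^sub>R v)) v"
    by simp
  moreover have "t < 1" using t(2) h(2) by linarith
  ultimately show ?thesis using t(1) that by blast
qed

section \<open>Lebesgue integrals under translations and dilations\<close>

lemma lborel_integral_shift:
  fixes f :: "'a::euclidean_space \<Rightarrow> real"
  assumes "integrable lborel f"
  shows "integrable lborel (\<lambda>x. f (x + c))" "(LINT x|lborel. f (x + c)) = (LINT x|lborel. f x)"
proof -
  have "has_bochner_integral (distr lborel borel ((+) c)) f (LINT x|lborel. f x)"
    using assms by (simp add: lborel_distr_plus has_bochner_integral_integrable)
  then have "has_bochner_integral lborel (\<lambda>x. f (c + x)) (LINT x|lborel. f x)"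
    using assms by (subst (asm) has_bochner_integral_iff, subst (asm) integrable_distr_eq, simp, simp add: borel_measurable_integrable,
        subst (asm) integral_distr) (auto simp: has_bochner_integral_iff dest: borel_measurable_integrable)
  then show "integrable lborel (\<lambda>x. f (x + c))" "(LINT x|lborel. f (x + c)) = (LINT x|lborel. f x)"
    by (auto simp: has_bochner_integral_iff add.commute)
qed

lemma lborel_integral_scale:
  fixes f :: "'a::euclidean_space \<Rightarrow> real"
  assumes f: "f \<in> borel_measurable borel" and a: "a > 0"
  shows "(LINT x|lborel. f x) = a ^ DIM('a) * (LINT x|lborel. f (a *\<^sub>R x))"
proof -
  have "(LINT x|lborel. f x) = (LINT x|density (distr lborel borel (\<lambda>x. 0 + a *\<^sub>R x)) (\<lambda>_. \<bar>a\<bar> ^ DIM('a)). f x)"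
    using lborel_affine[of a "0 :: 'a"] a by simp
  also have "\<dots> = (LINT x|distr lborel borel (\<lambda>x. a *\<^sub>R x). a ^ DIM('a) * f x)"
    using a f by (subst integral_real_density) auto
  also have "\<dots> = a ^ DIM('a) * (LINT x|lborel. f (a *\<^sub>R x))"
    using f by (subst integral_distr) auto
  finally show ?thesis .
qed

lemma integrable_compact_support:
  fixes f :: "'a::euclidean_space \<Rightarrow> real"
  assumes "compact S" "continuous_on S f" "\<And>x. x \<notin> S \<Longrightarrow> f x = 0"
  shows "integrable lborel f"
proof -
  have "integrable lborel (\<lambda>x. indicator S x *\<^sub>R f x)" using assms by (intro borel_integrable_compact)
  moreover have "(\<lambda>x. indicator S x *\<^sub>R f x) = f" using assms(3) by (auto simp: indicator_def fun_eq_iff)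
  ultimately show ?thesis by simp
qed

lemma compact_annulus: "compact {x :: 'a::euclidean_space. e \<le> norm x \<and> norm x \<le> R}"
proof -
  have "{x :: 'a. e \<le> norm x \<and> norm x \<le> R} = cball 0 R - ball 0 e" by auto
  then show ?thesis by (simp add: compact_diff)
qed

lemma bounded_compact_support:
  fixes f :: "'a::euclidean_space \<Rightarrow> real"
  assumes "compact S" "continuous_on S f" "\<And>x. x \<notin> S \<Longrightarrow> f x = 0"
  obtains M where "M \<ge> 0" "\<And>x. \<bar>f x\<bar> \<le> M"
proof -
  have "bounded (f ` S)" using assms compact_continuous_image compact_imp_bounded by blast
  then obtain M where "M > 0" "\<And>x. x \<in> S \<Longrightarrow> \<bar>f x\<bar> \<le> M" unfolding bounded_pos by auto
  then show ?thesis using assms(3) by (intro that[of M]) (auto, metis abs_zero less_imp_le)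
qed

lemma partial_zero_outside:
  assumes "\<And>x. norm x > R \<Longrightarrow> F x = 0" "norm x > R"
  shows "partial j F x = 0"
proof -
  have "open {x :: real ^ 'n. norm x > R}" by (intro open_Collect_less continuous_intros)
  then show ?thesis using partial_cong[of "{x. norm x > R}" x F "\<lambda>_. 0" j] assms by simp
qed

text \<open>Every difference quotient has integral zero by translation invariance, and dominated
  convergence carries this over to the derivative. Iterated integrals are avoided.\<close>

lemma integral_partial_zero:
  fixes F :: "real ^ 'n::finite \<Rightarrow> real"
  assumes F: "Ck_on 1 UNIV F" and supp: "\<And>x. norm x > R \<Longrightarrow> F x = 0"
  shows "has_bochner_integral lborel (partial j F) 0"
proof -
  let ?e = "axis j 1 :: real ^ 'n"
  define Q where "Q n x = real (Suc n) * (F (x + inverse (real (Suc n)) *\<^sub>R ?e) - F x)" for n x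
  have d: "\<And>x. F differentiable (at x)" using F Ck_on_differentiable by blast
  have c: "continuous_on S (partial j F)" "continuous_on S F" for S
    using F Ck_on_continuous[OF F] unfolding Ck_on_1_iff by (auto intro: continuous_on_subset)
  have supp': "partial j F x = 0" if "norm x > R" for x
    using partial_zero_outside[OF supp that] .
  have int: "integrable lborel (partial j F)" "integrable lborel F"
    using supp supp' by (auto intro!: integrable_compact_support[of "cball 0 R"] c)
  obtain M where M: "M \<ge> 0" "\<And>x. \<bar>partial j F x\<bar> \<le> M"
    by (rule bounded_compact_support[OF compact_cball c(1), of 0 R]) (use supp' in auto)
  \<comment> \<open>The shift has length at most 1, so all difference quotients live in the ball of
    radius \<open>R + 1\<close>.\<close>
  have Qb: "norm (Q n x) \<le> M * indicator (cball 0 (R + 1)) x" for n x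
  proof (cases "norm x \<le> R + 1")
    case True
    obtain t where "Q n x = partial j F (x + t *\<^sub>R ?e)"
      unfolding Q_def partial_def by (rule difference_quotient_mvt[OF d])
    then show ?thesis using True M(2) by simp
  next
    case False
    have "norm x - norm (inverse (real (Suc n)) *\<^sub>R ?e) \<le> norm (x + inverse (real (Suc n)) *\<^sub>R ?e)"
      by (metis norm_diff_ineq)
    moreover have "norm (inverse (real (Suc n)) *\<^sub>R ?e) \<le> 1" by (simp add: field_simps)
    ultimately have "R < norm (x + inverse (real (Suc n)) *\<^sub>R ?e)" "R < norm x"
      using False by linarith+
    then show ?thesis using supp M by (simp add: Q_def indicator_def)
  qed
  have Q0: "(LINT x|lborel. Q n x) = 0" for n
    unfolding Q_def using lborel_integral_shift[OF int(2)] int(2) by simp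
  have "(\<lambda>n. LINT x|lborel. Q n x) \<longlonglongrightarrow> (LINT x|lborel. partial j F x)"
  proof (rule integral_dominated_convergence[where w = "\<lambda>x. M * indicator (cball 0 (R + 1)) x"])
    show "partial j F \<in> borel_measurable lborel" using int by auto
    show "Q n \<in> borel_measurable lborel" for n
      unfolding Q_def using lborel_integral_shift(1)[OF int(2)] int(2) by auto
    show "integrable lborel (\<lambda>x :: real ^ 'n. M * indicator (cball 0 (R + 1)) x)"
      by (intro integrable_mult_right integrable_real_indicator) (auto simp: emeasure_bounded_finite[OF bounded_cball, unfolded infinity_ennreal_def])
    show "AE x in lborel. (\<lambda>n. Q n x) \<longlonglongrightarrow> partial j F x"
      unfolding Q_def partial_def using difference_quotient_tendsto[OF d] by auto
  qed (use Qb in auto)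
  then have "(LINT x|lborel. partial j F x) = 0" unfolding Q0 using LIMSEQ_unique by blast
  then show ?thesis using int by (simp add: has_bochner_integral_iff)
qed

lemma Ck_on_1_extend:
  fixes F :: "real ^ 'n::finite \<Rightarrow> real"
  assumes F: "Ck_on 1 (- {0}) F" and e: "0 < e" and supp: "\<And>x. norm x < e \<Longrightarrow> F x = 0"
  shows "Ck_on 1 UNIV F" "norm x < e \<Longrightarrow> partial j F x = 0"
proof -
  have 0: "Ck_on 1 (ball 0 e) F"
    by (rule Ck_on_1_cong[OF open_ball _ Ck_on_1_const[of _ 0]]) (use supp in auto)
  have U: "UNIV = - {0} \<union> ball (0 :: real ^ 'n) e" using e by auto
  show "Ck_on 1 UNIV F"
    using F 0 unfolding U Ck_on_1_iff
    by (intro conjI allI continuous_on_open_Un open_punctured open_ball) auto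
  show "partial j F x = 0" if "norm x < e"
    using partial_cong[OF open_ball, of x 0 e F "\<lambda>_. 0" j] supp that by simp
qed

text \<open>The formula for the divergence is available off the origin only. Since the fields vanish
  near the origin, \<open>G 0 = 0\<close> makes it valid everywhere, so no exceptional set has to be
  carried along.\<close>

lemma integral_divergence_zero:
  fixes F :: "'n \<Rightarrow> real ^ 'n::finite \<Rightarrow> real"
  assumes F: "\<And>j. Ck_on 1 (- {0}) (F j)" and e: "0 < e"
    and supp0: "\<And>j x. norm x < e \<Longrightarrow> F j x = 0" and supp: "\<And>j x. norm x > R \<Longrightarrow> F j x = 0"
    and G: "\<And>x. x \<noteq> 0 \<Longrightarrow> (\<Sum>j\<in>UNIV. partial j (F j) x) = G x" and G0: "G 0 = 0"
  shows "has_bochner_integral lborel G 0"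
proof -
  have "has_bochner_integral lborel (\<lambda>x. \<Sum>j\<in>UNIV. partial j (F j) x) (\<Sum>j\<in>(UNIV :: 'n set). 0)"
    by (intro has_bochner_integral_sum integral_partial_zero[OF Ck_on_1_extend(1)[OF F e supp0] supp])
  moreover have "(\<Sum>j\<in>UNIV. partial j (F j) x) = G x" for x
    using G[of x] G0 Ck_on_1_extend(2)[OF F e supp0] e by (cases "x = 0") auto
  ultimately show ?thesis by simp
qed

text \<open>For smooth \<open>q\<close> this would be an integration by parts. As \<open>q\<close>
  is only continuous, the derivative of \<open>h\<close> along x is replaced by difference quotients
  under dilations. The measure r^(-d) dx is dilation invariant, so the dilation moves from
  \<open>h\<close> over to \<open>q\<close>, where monotonicity along rays decides the sign.\<close>

lemma integral_radial_monotone: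
  fixes q h :: "real ^ 'n::finite \<Rightarrow> real"
  assumes q: "continuous_on (- {0}) q" and mono: "\<And>x a. x \<noteq> 0 \<Longrightarrow> 0 < a \<Longrightarrow> a \<le> 1 \<Longrightarrow> q (a *\<^sub>R x) \<le> q x"
    and h: "Ck_on 1 (- {0}) h" and nonneg: "\<And>x. h x \<ge> 0" and e: "0 < e"
    and supp0: "\<And>x. norm x < e \<Longrightarrow> h x = 0" and supp: "\<And>x. norm x > R \<Longrightarrow> h x = 0"
  defines "G \<equiv> \<lambda>x. norm x powr (- real CARD('n)) * q x * (\<Sum>j\<in>UNIV. x $ j * partial j h x)"
  shows "integrable lborel G" "(LINT x|lborel. G x) \<le> 0"
proof -
  define b where "b x = norm x powr (- real CARD('n)) * q x" for x
  define H where "H x = (\<Sum>j\<in>UNIV. x $ j * partial j h x)" for x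
  note h1 = Ck_on_1_extend(1)[OF h e supp0]
  have d: "\<And>x. h differentiable (at x)" using h1 Ck_on_differentiable by blast
  have p0: "partial j h x = 0" if "norm x < e" for j x
    using Ck_on_1_extend(2)[OF h e supp0 that] .
  have p1: "partial j h x = 0" if "norm x > R" for j x
    using partial_zero_outside[OF supp that] .
  have cH: "continuous_on S H" for S
    unfolding H_def using h1 by (intro continuous_intros) (auto simp: Ck_on_1_iff intro: continuous_on_subset)
  have ch: "continuous_on S h" for S using Ck_on_continuous[OF h1] continuous_on_subset by blast
  have cb: "continuous_on S b" if "0 \<notin> S" for S
    unfolding b_def using that by (intro continuous_intros continuous_on_subset[OF q]) auto
  \<comment> \<open>The inner radius is halved because \<open>h (a *\<^sub>R x)\<close> with
    \<open>a\<close> up to 2 can be nonzero as soon as \<open>norm x\<close> reaches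
    \<open>e / 2\<close>.\<close>
  let ?S = "{x :: real ^ 'n. e / 2 \<le> norm x \<and> norm x \<le> R}"
  have S0: "0 \<notin> ?S" using e by simp
  have H0: "H x = 0" if "norm x < e \<or> norm x > R" for x unfolding H_def using that p0 p1 by auto
  have hz: "h x = 0" if "norm x < e \<or> norm x > R" for x using that supp supp0 by blast
  have GH: "G x = b x * H x" for x by (simp add: G_def b_def H_def)
  have "integrable lborel (\<lambda>x. b x * H x)"
  proof (rule integrable_compact_support[OF compact_annulus])
    show "continuous_on ?S (\<lambda>x. b x * H x)" by (intro continuous_intros cb cH S0)
    show "b x * H x = 0" if "x \<notin> ?S" for x using that e H0[of x] by auto
  qed
  then show intG: "integrable lborel G" by (simp add: GH[abs_def])
  obtain M where M: "M \<ge> 0" "\<And>x. \<bar>H x\<bar> \<le> M"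
    by (rule bounded_compact_support[OF compact_cball cH, of 0 R]) (use H0 in auto)
  obtain M' where M': "M' \<ge> 0" "\<And>x. \<bar>indicator ?S x * b x\<bar> \<le> M'"
  proof (rule bounded_compact_support[OF compact_annulus, of "e / 2" R "\<lambda>x. indicator ?S x * b x"])
    show "continuous_on ?S (\<lambda>x. indicator ?S x * b x)"
      by (rule continuous_on_eq[OF cb[OF S0]]) simp
  qed auto
  define Q where "Q n x = b x * (real (Suc n) * (h (x + inverse (real (Suc n)) *\<^sub>R x) - h x))" for n x
  \<comment> \<open>Moving along the ray, the fixed direction \<open>x\<close> is the fraction 1 /
    (1 + t) of the current point \<open>y\<close>.\<close>
  have D: "frechet_derivative h (at y) x = H y / (1 + t)" if "y = x + t *\<^sub>R x" "t \<ge> 0" for x y t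
  proof -
    have "frechet_derivative h (at y) x = (\<Sum>j\<in>UNIV. x $ j * partial j h y)"
      by (simp add: derivative_as_sum_partial[OF d])
    also have "\<dots> = (\<Sum>j\<in>UNIV. y $ j * partial j h y / (1 + t))"
      using that by (intro sum.cong) (auto simp: field_simps)
    finally show ?thesis by (simp add: H_def sum_divide_distrib)
  qed
  have far: "norm (x + inverse (real (Suc n)) *\<^sub>R x) = (1 + inverse (real (Suc n))) * norm x" for x :: "real ^ 'n" and n
  proof -
    have "x + inverse (real (Suc n)) *\<^sub>R x = (1 + inverse (real (Suc n))) *\<^sub>R x" by (simp add: algebra_simps)
    then show ?thesis by (simp add: abs_of_pos add_pos_pos del: scaleR_left.add)
  qed
  have Q0: "Q n x = 0" if "x \<notin> ?S" for n x
  proof -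
    have "inverse (real (Suc n)) \<le> 1" by (simp add: field_simps)
    then have "inverse (real (Suc n)) * norm x \<le> norm x" by (intro mult_left_le_one_le) auto
    then have le: "norm x \<le> (1 + inverse (real (Suc n))) * norm x" "(1 + inverse (real (Suc n))) * norm x \<le> 2 * norm x"
      by (simp_all add: distrib_right)
    have "norm x < e / 2 \<or> norm x > R" using that by auto
    then have "norm x < e \<or> norm x > R"
        "norm (x + inverse (real (Suc n)) *\<^sub>R x) < e \<or> norm (x + inverse (real (Suc n)) *\<^sub>R x) > R"
      unfolding far using le e by linarith+
    then show ?thesis using hz unfolding Q_def by simp
  qed
  have Qb: "norm (Q n x) \<le> M' * M * indicator (cball 0 R) x" for n x
  proof (cases "x \<in> ?S")
    case True
    obtain t where t: "0 < t" "real (Suc n) * (h (x + inverse (real (Suc n)) *\<^sub>R x) - h x) = H (x + t *\<^sub>R x) / (1 + t)"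
      by (rule difference_quotient_mvt[OF d, of n x x]) (use D in \<open>metis less_imp_le\<close>)
    have "\<bar>H (x + t *\<^sub>R x) / (1 + t)\<bar> \<le> \<bar>H (x + t *\<^sub>R x)\<bar>" using t by (simp add: field_simps)
    also have "\<dots> \<le> M" by (rule M)
    finally have "\<bar>Q n x\<bar> \<le> M' * M" 
      unfolding Q_def t(2) abs_mult using M'(2)[of x] True M'(1) by (intro mult_mono) auto
    then show ?thesis using True by simp
  next
    case False
    then show ?thesis using Q0[of x n] M M' by simp
  qed
  have bm: "b \<in> borel_measurable borel"
  proof -
    have "(\<lambda>x. if x = 0 then 0 else b x) \<in> borel_measurable borel"
      using borel_measurable_continuous_on_if[of "{0 :: real ^ 'n}" "\<lambda>_. 0" b] cb[of "- {0}"] by auto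
    moreover have "(\<lambda>x. if x = 0 then 0 else b x) = b" by (auto simp: b_def)
    ultimately show ?thesis by simp
  qed
  have hm: "h \<in> borel_measurable borel" using ch by (rule borel_measurable_continuous_onI)
  have Qle: "(LINT x|lborel. Q n x) \<le> 0" for n
  proof -
    define a where "a = 1 + inverse (real (Suc n))"
    have a: "a > 1" "a \<le> 2" by (auto simp: a_def field_simps)
    have ia: "integrable lborel (\<lambda>x. b x * h (a *\<^sub>R x))"
    proof (rule integrable_compact_support[OF compact_annulus])
      show "continuous_on ?S (\<lambda>x. b x * h (a *\<^sub>R x))"
        by (intro continuous_intros cb S0 continuous_on_compose2[OF ch[of UNIV]]) auto
      show "b x * h (a *\<^sub>R x) = 0" if "x \<notin> ?S" for x
      proof -
        have "norm x < e / 2 \<or> norm x > R" using that by auto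
        moreover have "norm x \<le> a * norm x" "a * norm x \<le> 2 * norm x" using a by (auto simp: mult_right_mono mult_le_cancel_right1)
        ultimately have "norm (a *\<^sub>R x) < e \<or> norm (a *\<^sub>R x) > R"
          using a e unfolding norm_scaleR by (simp add: abs_of_pos) linarith
        then have "h (a *\<^sub>R x) = 0" by (rule hz)
        then show ?thesis by simp
      qed
    qed
    have i1: "integrable lborel (\<lambda>x. b x * h x)"
    proof (rule integrable_compact_support[OF compact_annulus])
      show "continuous_on ?S (\<lambda>x. b x * h x)" by (intro continuous_intros cb S0 ch)
      show "b x * h x = 0" if "x \<notin> ?S" for x using that e supp0[of x] supp[of x] by fastforce
    qed
    \<comment> \<open>This is the integrand after the substitution y = a x:
      \<open>f (a *\<^sub>R x)\<close> equals \<open>b x * h (a *\<^sub>R x)\<close>. The power of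
      \<open>a\<close> released by the weight r^(-d) matches the Jacobian.\<close>
    define f where "f y = b (inverse a *\<^sub>R y) * h y" for y
    have fm: "f \<in> borel_measurable borel" unfolding f_def using bm hm by measurable
    have "f y \<le> a ^ CARD('n) * (b y * h y)" for y
    proof (cases "y = 0")
      case False
      have "norm (inverse a *\<^sub>R y) powr (- real CARD('n)) = a ^ CARD('n) * norm y powr (- real CARD('n))"
        using a by (simp add: powr_mult inverse_powr powr_minus powr_realpow)
      then have "f y = a ^ CARD('n) * norm y powr (- real CARD('n)) * h y * q (inverse a *\<^sub>R y)"
        by (simp add: f_def b_def)
      also have "\<dots> \<le> a ^ CARD('n) * norm y powr (- real CARD('n)) * h y * q y"
        using a nonneg[of y] False by (intro mult_left_mono mono) (auto simp: field_simps)
      finally show ?thesis by (simp add: b_def mult_ac)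
    qed (use supp0 e in \<open>simp add: f_def\<close>)
    moreover have "integrable lborel f"
    proof -
      have "integrable lborel (\<lambda>x. f (a *\<^sub>R x))" using ia a by (simp add: f_def)
      then have "integrable (distr lborel borel (\<lambda>x. a *\<^sub>R x)) f"
        using fm by (subst integrable_distr_eq) auto
      then have "integrable (density (distr lborel borel (\<lambda>x. 0 + a *\<^sub>R x)) (\<lambda>_. \<bar>a\<bar> ^ CARD('n))) f"
        using fm a by (subst integrable_real_density) auto
      then show ?thesis using lborel_affine[of a "0 :: real ^ 'n"] a by simp
    qed
    ultimately have "(LINT y|lborel. f y) \<le> (LINT y|lborel. a ^ CARD('n) * (b y * h y))"
      using i1 by (intro integral_mono) auto
    moreover have "(LINT y|lborel. f y) = a ^ CARD('n) * (LINT x|lborel. b x * h (a *\<^sub>R x))"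
      using lborel_integral_scale[OF fm, of a] a by (simp add: f_def)
    ultimately have "(LINT x|lborel. b x * h (a *\<^sub>R x)) \<le> (LINT x|lborel. b x * h x)"
      using a by simp
    moreover have "Q n x = real (Suc n) * (b x * h (a *\<^sub>R x) - b x * h x)" for x
      by (simp add: Q_def a_def algebra_simps)
    ultimately show ?thesis using ia i1 by (simp add: mult_nonneg_nonpos)
  qed
  have "(\<lambda>n. LINT x|lborel. Q n x) \<longlonglongrightarrow> (LINT x|lborel. G x)"
  proof (rule integral_dominated_convergence[where w = "\<lambda>x. M' * M * indicator (cball 0 R) x"])
    show "G \<in> borel_measurable lborel" using intG by auto
    show "Q n \<in> borel_measurable lborel" for n
      unfolding Q_def using bm hm by measurable
    show "integrable lborel (\<lambda>x :: real ^ 'n. M' * M * indicator (cball 0 R) x)"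
      by (intro integrable_mult_right integrable_real_indicator) (auto simp: emeasure_bounded_finite[OF bounded_cball, unfolded infinity_ennreal_def])
    show "AE x in lborel. (\<lambda>n. Q n x) \<longlonglongrightarrow> G x"
    proof (rule AE_I2)
      fix x
      have "(\<lambda>n. Q n x) \<longlonglongrightarrow> b x * frechet_derivative h (at x) x"
        unfolding Q_def by (intro tendsto_intros difference_quotient_tendsto[OF d])
      then show "(\<lambda>n. Q n x) \<longlonglongrightarrow> G x" using D[of x x 0] by (simp add: GH)
    qed
  qed (use Qb in auto)
  then show "(LINT x|lborel. G x) \<le> 0" by (rule LIMSEQ_le_const2) (use Qle in auto)
qed

subsection \<open>Radial monotonicity of the potential\<close>

text \<open>The test function is the indicator of the part of a ball where \<open>W\<close> is
  negative but not below \<open>- m\<close>. The truncation keeps the negative integral finite, the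
  positive one is 0, and nothing is strictly less than 0; hence that part is null for each
  \<open>m\<close>.\<close>

lemma AE_nonneg_of_integral_inequality:
  fixes W :: "'a::euclidean_space \<Rightarrow> real"
  assumes W: "W \<in> borel_measurable borel"
    and less: "\<And>v :: 'a \<Rightarrow> complex.
      \<lbrakk> v \<in> borel_measurable lebesgue; \<not> (AE x in lebesgue. v x = 0);
        (\<integral>\<^sup>+x. ennreal (neg_part (W x) * (cmod (v x))\<^sup>2) \<partial>lebesgue) < \<infinity>;
        (\<integral>\<^sup>+x. ennreal (pos_part (W x) * (cmod (v x))\<^sup>2) \<partial>lebesgue) < \<infinity> \<rbrakk>
      \<Longrightarrow> (\<integral>\<^sup>+x. ennreal (neg_part (W x) * (cmod (v x))\<^sup>2) \<partial>lebesgue)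
        < (\<integral>\<^sup>+x. ennreal (pos_part (W x) * (cmod (v x))\<^sup>2) \<partial>lebesgue)"
  shows "AE x in lborel. 0 \<le> W x"
proof -
  have "AE x in lborel. \<not> (norm x \<le> real m \<and> - real m \<le> W x \<and> W x < 0)" for m :: nat
  proof -
    define S where "S = {x. norm x \<le> real m \<and> - real m \<le> W x \<and> W x < 0}"
    have S: "S \<in> sets borel" unfolding S_def using W by measurable
    define v :: "'a \<Rightarrow> complex" where "v x = of_real (indicator S x)" for x
    have v: "v \<in> borel_measurable borel" unfolding v_def using S by measurable
    have "pos_part (W x) * (cmod (v x))\<^sup>2 = 0" for x
      by (auto simp: v_def S_def pos_part_def indicator_def)
    then have pos: "(\<integral>\<^sup>+x. ennreal (pos_part (W x) * (cmod (v x))\<^sup>2) \<partial>lebesgue) = 0"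
      by (simp only: ennreal_0 nn_integral_const mult_zero_left)
    have neg: "(\<integral>\<^sup>+x. ennreal (neg_part (W x) * (cmod (v x))\<^sup>2) \<partial>lebesgue) < \<infinity>"
    proof -
      have "(\<integral>\<^sup>+x. ennreal (neg_part (W x) * (cmod (v x))\<^sup>2) \<partial>lebesgue)
          \<le> (\<integral>\<^sup>+x. ennreal (real m) * indicator (cball (0 :: 'a) (real m)) x \<partial>lebesgue)"
      proof (rule nn_integral_mono)
        fix x :: 'a
        show "ennreal (neg_part (W x) * (cmod (v x))\<^sup>2) \<le> ennreal (real m) * indicator (cball 0 (real m)) x"
          by (auto simp: v_def S_def neg_part_def indicator_def intro!: ennreal_leI)
      qed
      also have "\<dots> = ennreal (real m) * emeasure lborel (cball (0 :: 'a) (real m))"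
        by (subst nn_integral_cmult_indicator) auto
      also have "\<dots> < \<infinity>"
        using emeasure_bounded_finite[OF bounded_cball, of "0 :: 'a" "real m"]
        by (auto simp: ennreal_mult_less_top)
      finally show ?thesis .
    qed
    have "AE x in lebesgue. v x = 0"
    proof (rule ccontr)
      assume n: "\<not> (AE x in lebesgue. v x = 0)"
      have "(\<integral>\<^sup>+x. ennreal (neg_part (W x) * (cmod (v x))\<^sup>2) \<partial>lebesgue)
          < (\<integral>\<^sup>+x. ennreal (pos_part (W x) * (cmod (v x))\<^sup>2) \<partial>lebesgue)"
        by (rule less[OF _ n neg]) (use v pos in \<open>auto simp: measurable_completion\<close>)
      then show False by (simp add: pos)
    qed
    then have "AE x in lborel. v x = 0"
      by (subst (asm) AE_completion_iff) (use v in measurable)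
    then show ?thesis by eventually_elim (auto simp: v_def S_def indicator_def)
  qed
  then have "AE x in lborel. \<forall>m :: nat. \<not> (norm x \<le> real m \<and> - real m \<le> W x \<and> W x < 0)"
    by (subst AE_all_countable) auto
  then show ?thesis
  proof eventually_elim
    fix x assume *: "\<forall>m :: nat. \<not> (norm x \<le> real m \<and> - real m \<le> W x \<and> W x < 0)"
    obtain m :: nat where "max (norm x) (- W x) \<le> real m" using real_arch_simple by blast
    then show "0 \<le> W x" using *[rule_format, of m] by auto
  qed
qed

lemma AE_lborel_scale:
  fixes P :: "'a::euclidean_space \<Rightarrow> bool"
  assumes P: "AE x in lborel. P x" and m: "{x. P x} \<in> sets borel" and s: "s > 0"
  shows "AE x in lborel. P (s *\<^sub>R x)"
proof -
  have "AE x in density (distr lborel borel (\<lambda>x. 0 + s *\<^sub>R x)) (\<lambda>_. \<bar>s\<bar> ^ DIM('a)). P x"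
    by (subst lborel_affine[of s "0 :: 'a", symmetric]) (use s P in auto)
  then have "AE x in distr lborel borel (\<lambda>x :: 'a. 0 + s *\<^sub>R x). P x"
    using s by (subst (asm) AE_density) auto
  then show ?thesis using m by (subst (asm) AE_distr_iff) auto
qed

text \<open>The expression in the hypothesis on the potential is r^(-2) times the derivative of r^2
  V along x, so its sign governs r^2 V on rays.\<close>

lemma radial_derivative_identities:
  fixes V :: "real ^ 'n::finite \<Rightarrow> real"
  assumes V: "V differentiable (at x)" and x: "x \<noteq> 0"
  defines "W \<equiv> radial_deriv (\<lambda>y. norm y * V y) x + V x"
  shows "W = frechet_derivative V (at x) x + 2 * V x"
    and "(\<lambda>y. (norm y)\<^sup>2 * V y) differentiable (at x)"
    and "frechet_derivative (\<lambda>y. (norm y)\<^sup>2 * V y) (at x) x = (norm x)\<^sup>2 * W"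
proof -
  have n: "norm differentiable (at x)" using partial_norm(2)[OF x] .
  have sq: "(\<Sum>j\<in>UNIV. x $ j * x $ j) = (norm x)\<^sup>2"
    by (simp add: power2_norm_eq_inner inner_vec_def)
  have fV: "frechet_derivative V (at x) x = (\<Sum>j\<in>UNIV. x $ j * partial j V x)"
    by (simp add: derivative_as_sum_partial[OF V])
  have "radial_deriv (\<lambda>y. norm y * V y) x
      = (\<Sum>j\<in>UNIV. x $ j * partial j V x + x $ j * x $ j * (V x / (norm x)\<^sup>2))"
    unfolding radial_deriv_def
    using x by (intro sum.cong refl)
      (simp add: partial_bilinear[OF bounded_bilinear_mult n V] partial_norm(1)[OF x] field_simps power2_eq_square)
  also have "\<dots> = frechet_derivative V (at x) x + V x"
    unfolding sum.distrib sum_distrib_right[symmetric] sq fV using x by simp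
  finally show W: "W = frechet_derivative V (at x) x + 2 * V x" by (simp add: W_def)
  have r: "radial_weight (\<lambda>x :: real ^ 'n. (norm x)\<^sup>2) (\<lambda>x. norm x * (2 * norm x))"
    by (rule radial_weight_norm[of "\<lambda>r. r\<^sup>2" "\<lambda>r. 2 * r"]) (auto intro!: derivative_eq_intros continuous_intros)
  note r = radial_weightD(2,3)[OF r x]
  show d: "(\<lambda>y. (norm y)\<^sup>2 * V y) differentiable (at x)"
    by (rule differentiable_bilinear[OF bounded_bilinear_mult r(1) V])
  have "frechet_derivative (\<lambda>y. (norm y)\<^sup>2 * V y) (at x) x
      = (\<Sum>j\<in>UNIV. (norm x)\<^sup>2 * (x $ j * partial j V x) + x $ j * x $ j * (2 * V x))"
    unfolding derivative_as_sum_partial[OF d] 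
    unfolding partial_bilinear[OF bounded_bilinear_mult r(1) V] r(2)
    using x by (intro sum.cong refl) (simp add: field_simps power2_eq_square)
  also have "\<dots> = (norm x)\<^sup>2 * W"
    unfolding sum.distrib sum_distrib_right[symmetric] sum_distrib_left[symmetric] sq W fV
    by (simp add: algebra_simps)
  finally show "frechet_derivative (\<lambda>y. (norm y)\<^sup>2 * V y) (at x) x = (norm x)\<^sup>2 * W" .
qed

text \<open>Changing a function at a single point preserves measurability, so whatever value
  \<open>f\<close> has at the origin is harmless.\<close>

lemma borel_measurable_punctured:
  fixes f :: "'a::euclidean_space \<Rightarrow> 'b::real_normed_vector"
  assumes "continuous_on (- {0}) f"
  shows "f \<in> borel_measurable borel"
proof -
  have "(\<lambda>x. if x \<in> {0} then f 0 else f x) \<in> borel_measurable borel"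
    by (rule borel_measurable_continuous_on_if) (use assms in \<open>auto simp: Compl_eq_Diff_UNIV\<close>)
  moreover have "(\<lambda>x. if x \<in> {0} then f 0 else f x) = f" by auto
  ultimately show ?thesis by simp
qed

text \<open>
  The potential is merely differentiable, so its radial derivative need not be locally
  integrable; the gauge integral still recovers a function from an everywhere existing
  derivative, whose values on a null set are irrelevant.
\<close>

lemma radial_monotone:
  fixes V :: "real ^ 'n::finite \<Rightarrow> real"
  assumes V: "\<And>x. x \<noteq> 0 \<Longrightarrow> V differentiable (at x)"
  defines "W \<equiv> \<lambda>x. radial_deriv (\<lambda>y. norm y * V y) x + V x"
  assumes less: "\<And>v :: real ^ 'n \<Rightarrow> complex.
      \<lbrakk> v \<in> borel_measurable lebesgue; \<not> (AE x in lebesgue. v x = 0);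
        (\<integral>\<^sup>+x. ennreal (neg_part (W x) * (cmod (v x))\<^sup>2) \<partial>lebesgue) < \<infinity>;
        (\<integral>\<^sup>+x. ennreal (pos_part (W x) * (cmod (v x))\<^sup>2) \<partial>lebesgue) < \<infinity> \<rbrakk>
      \<Longrightarrow> (\<integral>\<^sup>+x. ennreal (neg_part (W x) * (cmod (v x))\<^sup>2) \<partial>lebesgue)
        < (\<integral>\<^sup>+x. ennreal (pos_part (W x) * (cmod (v x))\<^sup>2) \<partial>lebesgue)"
  assumes x: "x \<noteq> 0" and a: "0 < a" "a \<le> 1"
  shows "(norm (a *\<^sub>R x))\<^sup>2 * V (a *\<^sub>R x) \<le> (norm x)\<^sup>2 * V x"
proof -
  define q where "q y = (norm y)\<^sup>2 * V y" for y
  have cV: "continuous_on (- {0}) V"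
    using V by (auto intro!: differentiable_imp_continuous_on simp: differentiable_on_def differentiable_at_withinI)
  have Vm: "V \<in> borel_measurable borel" by (rule borel_measurable_punctured[OF cV])
  have Wm: "W \<in> borel_measurable borel"
  proof -
    \<comment> \<open>\<open>W\<close> may be discontinuous; its measurability comes from being a
      pointwise limit of difference quotients of \<open>V\<close> along x. The origin is given the
      value \<open>W 0\<close> so that the limit is correct there too.\<close>
    define Q where "Q n y = (if y = 0 then W 0 else
        real (Suc n) * (V (y + inverse (real (Suc n)) *\<^sub>R y) - V y) + 2 * V y)" for n y
    show ?thesis
    proof (rule borel_measurable_LIMSEQ_real)
      show "Q n \<in> borel_measurable borel" for n
        unfolding Q_def using Vm by measurable
      show "(\<lambda>n. Q n y) \<longlonglongrightarrow> W y" for y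
      proof (cases "y = 0")
        case False
        have "(\<lambda>n. real (Suc n) * (V (y + inverse (real (Suc n)) *\<^sub>R y) - V y) + 2 * V y)
            \<longlonglongrightarrow> frechet_derivative V (at y) y + 2 * V y"
          by (intro tendsto_intros difference_quotient_tendsto V False)
        then show ?thesis
          using False radial_derivative_identities(1)[OF V[OF False] False] by (simp add: Q_def W_def add_ac)
      qed (simp add: Q_def)
    qed
  qed
  have AEW: "AE y in lborel. 0 \<le> W y"
    by (rule AE_nonneg_of_integral_inequality[OF Wm less])
  have mW: "{y. 0 \<le> W y} \<in> sets borel" using Wm by measurable
  have pair: "pair_sigma_finite (lborel :: real measure) (lborel :: (real ^ 'n) measure)" ..
  \<comment> \<open>For each fixed positive \<open>s\<close> the dilation preserves null sets.
    Exchanging the two variables then gives, for almost every \<open>y\<close>, the sign of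
    \<open>W\<close> at almost every point of the ray through \<open>y\<close>.\<close>
  have "AE s in lborel. AE y in lborel. 0 < (s::real) \<longrightarrow> 0 \<le> W (s *\<^sub>R y)"
  proof (rule AE_I2)
    fix s :: real
    show "AE y in lborel. 0 < s \<longrightarrow> 0 \<le> W (s *\<^sub>R y)"
      using AE_lborel_scale[OF AEW mW, of s] by (cases "0 < s") auto
  qed
  moreover have "{z \<in> space (lborel \<Otimes>\<^sub>M lborel). 0 < (fst z::real) \<longrightarrow> 0 \<le> W (fst z *\<^sub>R snd z)}
      \<in> sets (lborel \<Otimes>\<^sub>M lborel)"
    using Wm by measurable
  ultimately have AE: "AE y in lborel. AE s in lborel. 0 < (s::real) \<longrightarrow> 0 \<le> W (s *\<^sub>R y)"
    using pair_sigma_finite.AE_commute[OF pair, of "\<lambda>s y. 0 < s \<longrightarrow> 0 \<le> W (s *\<^sub>R y)"] by blast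
  have mono: "q (a *\<^sub>R y) \<le> q y" if y: "y \<noteq> 0" and AEs: "AE s in lborel. 0 < (s::real) \<longrightarrow> 0 \<le> W (s *\<^sub>R y)" for y
  proof -
    define g' where "g' s = frechet_derivative q (at (0 + s *\<^sub>R y)) y" for s :: real
    have q_id: "g' s = s * ((norm y)\<^sup>2 * W (s *\<^sub>R y))" if s: "s > 0" for s
    proof -
      have s0: "s *\<^sub>R y \<noteq> 0" using s y by simp
      have "linear (frechet_derivative q (at (s *\<^sub>R y)))"
        using radial_derivative_identities(2)[OF V[OF s0] s0] unfolding q_def[abs_def]
        by (rule linear_frechet_derivative)
      then have "s * g' s = frechet_derivative q (at (s *\<^sub>R y)) (s *\<^sub>R y)"
        by (simp add: g'_def linear_cmul)
      also have "\<dots> = (norm (s *\<^sub>R y))\<^sup>2 * W (s *\<^sub>R y)"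
        using radial_derivative_identities(3)[OF V[OF s0] s0] unfolding q_def[abs_def] W_def .
      finally show ?thesis using s by (simp add: power_mult_distrib power2_eq_square)
    qed
    have "(g' has_integral q (0 + 1 *\<^sub>R y) - q (0 + a *\<^sub>R y)) {a..1}"
    proof (rule fundamental_theorem_of_calculus[OF a(2)])
      fix s assume "s \<in> {a..1}"
      then have s0: "0 + s *\<^sub>R y \<noteq> 0" using a y by simp
      have "((\<lambda>s. q (0 + s *\<^sub>R y)) has_real_derivative g' s) (at s)"
        unfolding g'_def
        by (rule derivative_along_line)
           (use radial_derivative_identities(2)[OF V[OF s0] s0] in \<open>simp add: q_def[abs_def]\<close>)
      then show "((\<lambda>s. q (0 + s *\<^sub>R y)) has_vector_derivative g' s) (at s within {a..1})"
        by (auto simp: has_real_derivative_iff_has_vector_derivative intro: has_vector_derivative_at_within)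
    qed
    then have I: "(g' has_integral q y - q (a *\<^sub>R y)) {a..1}" by simp
    define Z where "Z = {s. \<not> (0 < s \<longrightarrow> 0 \<le> W (s *\<^sub>R y))}"
    have Z: "negligible Z"
      using AE_completion[OF AEs] unfolding Z_def
      by (simp add: negligible_iff_null_sets completion.AE_iff_null_sets AE_iff_null_sets)
    have "((\<lambda>s. if s \<in> Z then 0 else g' s) has_integral q y - q (a *\<^sub>R y)) {a..1}"
      by (rule has_integral_spike[OF Z _ I]) auto
    then have "0 \<le> q y - q (a *\<^sub>R y)"
      by (rule has_integral_nonneg) (use a q_id in \<open>auto simp: Z_def\<close>)
    then show ?thesis by simp
  qed
  show ?thesis
  proof (rule ccontr)
    assume "\<not> ?thesis"
    then have neg: "q x - q (a *\<^sub>R x) < 0" by (simp add: q_def)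
    \<comment> \<open>Monotonicity is known on almost every ray only. By continuity a violation at
      \<open>x\<close> would persist on a nonempty open set, which cannot be null.\<close>
    define U where "U = - {0} \<inter> (\<lambda>y. q y - q (a *\<^sub>R y)) -` {..<0}"
    have cq: "continuous_on (- {0}) q" unfolding q_def by (intro continuous_intros cV)
    have "continuous_on (- {0}) (\<lambda>y. q y - q (a *\<^sub>R y))"
      using a by (intro continuous_intros cq continuous_on_compose2[OF cq]) auto
    then have U: "open U" unfolding U_def by (intro continuous_open_preimage open_punctured open_lessThan)
    have "x \<in> U" using neg x by (simp add: U_def)
    then have "\<not> negligible U" using U open_not_negligible by blast
    moreover have "AE y in lborel. y \<notin> U"
      using AE by eventually_elim (use mono in \<open>force simp: U_def\<close>)
    then have "negligible U"
      using U by (subst (asm) AE_iff_null_sets[symmetric]) (auto simp: negligible_iff_null_sets null_sets_completionI)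
    ultimately show False by blast
  qed
qed

subsection \<open>The weighted inequality away from the origin\<close>

text \<open>Pure algebra at one point: \<open>p\<close> stands for r^(-d), \<open>N\<close> for r^2,
  \<open>L\<close> for the magnetic Laplacian of \<open>w\<close>, \<open>X\<close> for its dilation
  derivative, \<open>En\<close> for its energy and \<open>q\<close> for r^2 V. The first six
  brackets on the right are divergences, the one with \<open>q\<close> is the monotone term, and the
  last consists of squares, \<open>P + (2 * \<tau>) *\<^sub>R X\<close> being the symmetric part
  applied to \<open>w\<close>. The energy disappears because the weight r^(2 - d) reduces its
  contribution in the first bracket to a boundary term, which the second bracket removes.\<close>

lemma weighted_inequality_identity:
  fixes p N d c lam q \<tau> \<theta> \<kappa> \<kappa>' \<kappa>'' En :: real and L X w P :: complex
  assumes N: "N \<noteq> 0"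
    and P: "P = N *\<^sub>R L - (d - 2 + 2 * \<tau>) *\<^sub>R X + (c + q + lam * N) *\<^sub>R w"
  shows "p * (\<theta> * (P \<bullet> P) - 4 * \<tau> * lam * \<theta> * N * (w \<bullet> w) - 2 * \<tau> * \<kappa> * (P \<bullet> w) + 2 * \<tau> * (\<tau> * \<kappa>' + \<kappa>'' / 2) * (w \<bullet> w))
     = - 4 * \<tau> * ((\<theta> * (p * N)) * (L \<bullet> X + (1 - d / 2) * En) + (\<theta> * ((2 - d) * (p * N)) + \<kappa> * (p * N)) * (X \<bullet> X / N - En / 2))
       - 2 * \<tau> * ((\<kappa> * (p * N)) * (L \<bullet> w + En) + (\<kappa> * ((2 - d) * (p * N)) + \<kappa>' * (p * N)) / N * (X \<bullet> w))
       - 2 * \<tau> * c * ((d * (\<theta> * p) + (\<theta> * (- d * p) + \<kappa> * p)) * (w \<bullet> w) + 2 * (\<theta> * p) * (X \<bullet> w))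
       + 2 * \<tau>\<^sup>2 * ((d * (\<kappa> * p) + (\<kappa> * (- d * p) + \<kappa>' * p)) * (w \<bullet> w) + 2 * (\<kappa> * p) * (X \<bullet> w))
       + \<tau> * ((d * (\<kappa>' * p) + (\<kappa>' * (- d * p) + \<kappa>'' * p)) * (w \<bullet> w) + 2 * (\<kappa>' * p) * (X \<bullet> w))
       - 2 * \<tau> * lam * ((d * (\<theta> * (p * N)) + (\<theta> * ((2 - d) * (p * N)) + \<kappa> * (p * N))) * (w \<bullet> w) + 2 * (\<theta> * (p * N)) * (X \<bullet> w))
       - 2 * \<tau> * (p * q * (2 * \<theta> * (X \<bullet> w) + \<kappa> * (w \<bullet> w)))
       + p * (\<theta> * ((P + (2 * \<tau>) *\<^sub>R X) \<bullet> (P + (2 * \<tau>) *\<^sub>R X)) + 4 * \<tau>\<^sup>2 * \<theta> * (X \<bullet> X) + 4 * \<tau> * \<kappa> * (X \<bullet> X))"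
proof -
  have PX: "P \<bullet> X = N * (L \<bullet> X) - (d - 2 + 2 * \<tau>) * (X \<bullet> X) + (c + q + lam * N) * (X \<bullet> w)"
    unfolding P inner_add_left inner_diff_left inner_scaleR_left by (simp add: inner_commute[of w X])
  have Pw: "P \<bullet> w = N * (L \<bullet> w) - (d - 2 + 2 * \<tau>) * (X \<bullet> w) + (c + q + lam * N) * (w \<bullet> w)"
    unfolding P inner_add_left inner_diff_left inner_scaleR_left ..
  have PPX: "(P + (2 * \<tau>) *\<^sub>R X) \<bullet> (P + (2 * \<tau>) *\<^sub>R X) = P \<bullet> P + 4 * \<tau> * (P \<bullet> X) + 4 * \<tau>\<^sup>2 * (X \<bullet> X)"
    unfolding inner_add_left inner_add_right inner_scaleR_left inner_scaleR_right
    by (simp add: inner_commute[of X P] power2_eq_square algebra_simps)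
  show ?thesis
    unfolding PPX PX Pw
    using N by (simp add: field_simps power2_eq_square)
qed

context transversal_field
begin

lemma Ck_on_imp_continuous_cov:
  assumes "Ck_on 1 (- {0}) f"
  shows "continuous_on (- {0}) (E j f)"
  unfolding cov_deriv_def[abs_def]
  using assms Ck_on_continuous[OF assms]
  by (intro continuous_intros Ck_on_continuous[OF A_component]) (auto simp: Ck_on_1_iff)

lemma continuous_magnetic_laplacian:
  assumes "Ck_on 2 (- {0}) w"
  shows "continuous_on (- {0}) (magnetic_laplacian A w)"
  unfolding magnetic_laplacian_def[abs_def]
  by (intro continuous_intros Ck_on_imp_continuous_cov Ck_on_cov assms)

lemma cov_zero_outside:
  assumes "\<And>x. norm x > R \<Longrightarrow> w x = 0" "norm x > R"
  shows "E j w x = 0" "D w x = 0" "energy w x = 0" "magnetic_laplacian A w x = 0"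
proof -
  have *: "E j w x = 0" if "norm x > R" for j x
    using partial_zero_outside[OF assms(1) that] assms(1)[OF that] by (simp add: cov_deriv_def)
  have **: "E j (E j w) x = 0" if "norm x > R" for j x
    using partial_zero_outside[OF * that] *[OF that] by (simp add: cov_deriv_def[of A j "E j w"])
  show "E j w x = 0" "D w x = 0" "energy w x = 0" "magnetic_laplacian A w x = 0"
    using * ** assms(2) by (auto simp: dilation_def energy_def magnetic_laplacian_def)
qed

section \<open>Integrated divergence identities\<close>

lemma integral_dilation:
  fixes \<rho> \<rho>' :: "real ^ 'n \<Rightarrow> real"
  assumes w: "Ck_on 2 (- {0}) w" and \<rho>: "radial_weight \<rho> \<rho>'" and e: "e > 0"
    and z: "\<And>x. norm x < e \<Longrightarrow> \<rho> x = 0" "\<rho>' 0 = 0" and R: "\<And>x. norm x > R \<Longrightarrow> w x = 0"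
  shows "has_bochner_integral lborel
     (\<lambda>x. \<rho> x * (magnetic_laplacian A w x \<bullet> D w x + (1 - CARD('n) / 2) * energy w x)
      + \<rho>' x * (D w x \<bullet> D w x / (norm x)\<^sup>2 - energy w x / 2)) 0"
proof (rule integral_divergence_zero[OF _ e])
  fix j :: 'n
  show "Ck_on 1 (- {0}) (\<lambda>y. \<rho> y * (E j w y \<bullet> D w y - (y $ j / 2) * energy w y))"
    by (intro Ck_on_1_mult Ck_on_1_diff Ck_on_1_inner Ck_on_cov Ck_on_dilation Ck_on_energy w
        radial_weightD(1)[OF \<rho>] Ck_on_1_linear[OF bounded_linear_divide Ck_on_1_component])
  show "\<rho> x * (E j w x \<bullet> D w x - (x $ j / 2) * energy w x) = 0" if "norm x < e" for x
    using z(1)[OF that] by simp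
  show "\<rho> x * (E j w x \<bullet> D w x - (x $ j / 2) * energy w x) = 0" if "norm x > R" for x
    using cov_zero_outside[OF R that] by simp
qed (use divergence_dilation[OF w \<rho>] z e in auto)

lemma integral_energy:
  fixes \<rho> \<rho>' :: "real ^ 'n \<Rightarrow> real"
  assumes w: "Ck_on 2 (- {0}) w" and \<rho>: "radial_weight \<rho> \<rho>'" and e: "e > 0"
    and z: "\<And>x. norm x < e \<Longrightarrow> \<rho> x = 0" and R: "\<And>x. norm x > R \<Longrightarrow> w x = 0"
  shows "has_bochner_integral lborel
     (\<lambda>x. \<rho> x * (magnetic_laplacian A w x \<bullet> w x + energy w x) + \<rho>' x / (norm x)\<^sup>2 * (D w x \<bullet> w x)) 0"
proof (rule integral_divergence_zero[OF _ e])
  fix j :: 'n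
  show "Ck_on 1 (- {0}) (\<lambda>y. \<rho> y * (E j w y \<bullet> w y))"
    by (intro Ck_on_1_mult Ck_on_1_inner Ck_on_cov w Ck_on_2_imp_1 radial_weightD(1)[OF \<rho>])
  show "\<rho> x * (E j w x \<bullet> w x) = 0" if "norm x < e" for x
    using z(1)[OF that] by simp
  show "\<rho> x * (E j w x \<bullet> w x) = 0" if "norm x > R" for x
    using R[OF that] by simp
qed (use divergence_energy[OF w \<rho>] z e in auto)

lemma integral_radial:
  fixes \<rho> \<rho>' :: "real ^ 'n \<Rightarrow> real"
  assumes w: "Ck_on 1 (- {0}) w" and \<rho>: "radial_weight \<rho> \<rho>'" and e: "e > 0"
    and z: "\<And>x. norm x < e \<Longrightarrow> \<rho> x = 0" "\<rho>' 0 = 0" and R: "\<And>x. norm x > R \<Longrightarrow> w x = 0"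
  shows "has_bochner_integral lborel
     (\<lambda>x. (CARD('n) * \<rho> x + \<rho>' x) * (w x \<bullet> w x) + 2 * \<rho> x * (D w x \<bullet> w x)) 0"
proof (rule integral_divergence_zero[OF _ e])
  fix j :: 'n
  show "Ck_on 1 (- {0}) (\<lambda>y. \<rho> y * (y $ j * (w y \<bullet> w y)))"
    by (intro Ck_on_1_mult Ck_on_1_inner w Ck_on_1_component radial_weightD(1)[OF \<rho>])
  show "\<rho> x * (x $ j * (w x \<bullet> w x)) = 0" if "norm x < e" for x
    using z(1)[OF that] by simp
  show "\<rho> x * (x $ j * (w x \<bullet> w x)) = 0" if "norm x > R" for x
    using R[OF that] by simp
qed (use divergence_radial[OF w \<rho>] z e in auto)

text \<open>
  The cutoff produces the boundary terms with \<open>\<kappa>\<close>. The angular energy and the potential in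
  them have no sign; testing the equation with \<open>\<kappa> w\<close> removes both at once.
\<close>

lemma weighted_inequality:
  fixes \<theta> \<kappa> \<kappa>' \<kappa>'' q :: "real ^ 'n \<Rightarrow> real" and c lam \<tau> :: real
  assumes w: "Ck_on 2 (- {0}) w" and R: "\<And>x. norm x > R \<Longrightarrow> w x = 0"
    and rw: "radial_weight \<theta> \<kappa>" "radial_weight \<kappa> \<kappa>'" "radial_weight \<kappa>' \<kappa>''"
    and cont: "continuous_on (- {0}) \<kappa>''"
    and nonneg: "\<And>x. \<theta> x \<ge> 0" "\<And>x. \<kappa> x \<ge> 0"
    and e: "e > 0" and z: "\<And>x. norm x < e \<Longrightarrow> \<theta> x = 0 \<and> \<kappa> x = 0 \<and> \<kappa>' x = 0 \<and> \<kappa>'' x = 0"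
    and q: "continuous_on (- {0}) q"
    and mono: "\<And>x a. x \<noteq> 0 \<Longrightarrow> 0 < a \<Longrightarrow> a \<le> 1 \<Longrightarrow> q (a *\<^sub>R x) \<le> q x"
    and tau: "\<tau> \<ge> 0"
  defines "P \<equiv> \<lambda>x. (norm x)\<^sup>2 *\<^sub>R magnetic_laplacian A w x - (real CARD('n) - 2 + 2 * \<tau>) *\<^sub>R D w x
      + (c + q x + lam * (norm x)\<^sup>2) *\<^sub>R w x"
  defines "\<Phi> \<equiv> \<lambda>x. norm x powr (- real CARD('n)) * (\<theta> x * (P x \<bullet> P x) - 4 * \<tau> * lam * \<theta> x * (norm x)\<^sup>2 * (w x \<bullet> w x)
        - 2 * \<tau> * \<kappa> x * (P x \<bullet> w x) + 2 * \<tau> * (\<tau> * \<kappa>' x + \<kappa>'' x / 2) * (w x \<bullet> w x))"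
  shows "integrable lborel \<Phi>" "0 \<le> (LINT x|lborel. \<Phi> x)"
proof -
  let ?d = "real CARD('n)"
  define p where "p x = norm x powr (- ?d)" for x :: "real ^ 'n"
  define p2 where "p2 x = norm x powr (2 - ?d)" for x :: "real ^ 'n"
  have rp: "radial_weight p (\<lambda>x. - ?d * p x)" "radial_weight p2 (\<lambda>x. (2 - ?d) * p2 x)"
    unfolding p_def[abs_def] p2_def[abs_def] by (rule radial_weight_powr)+
  \<comment> \<open>By convention \<open>0 powr a\<close> is 0 for every exponent, so even the
    singular weights vanish at the origin.\<close>
  have p0: "p 0 = 0" "p2 0 = 0" by (simp_all add: p_def p2_def)
  have p2: "p2 x = p x * (norm x)\<^sup>2" for x
    by (cases "x = 0") (simp_all add: p_def p2_def powr_add[of _ 2 "- ?d", simplified] mult.commute)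
  have pnn: "p x \<ge> 0" for x by (simp add: p_def)
  have z0: "\<theta> 0 = 0" "\<kappa> 0 = 0" "\<kappa>' 0 = 0" "\<kappa>'' 0 = 0" using z[of 0] e by auto
  note w1 = Ck_on_2_imp_1[OF w]
  have cw: "continuous_on (- {0}) w" by (rule Ck_on_continuous[OF w1])
  have cD: "continuous_on (- {0}) (D w)" by (rule Ck_on_continuous[OF Ck_on_dilation[OF w]])
  have cP: "continuous_on (- {0}) P" unfolding P_def
    by (intro continuous_intros continuous_magnetic_laplacian w cD cw q)
  have c\<Phi>: "continuous_on (- {0}) \<Phi>" unfolding \<Phi>_def
    by (intro continuous_intros cont cP cw Ck_on_continuous[OF radial_weightD(1)[OF rw(1)]]
       Ck_on_continuous[OF radial_weightD(1)[OF rw(2)]] Ck_on_continuous[OF radial_weightD(1)[OF rw(3)]]) auto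
  show int: "integrable lborel \<Phi>"
  proof (rule integrable_compact_support[OF compact_annulus])
    show "continuous_on {x. e \<le> norm x \<and> norm x \<le> R} \<Phi>"
      by (rule continuous_on_subset[OF c\<Phi>]) (use e in auto)
    fix x :: "real ^ 'n" assume "x \<notin> {x. e \<le> norm x \<and> norm x \<le> R}"
    then consider "norm x < e" | "norm x > R" by force
    then show "\<Phi> x = 0"
    proof cases
      case 1
      then show ?thesis using z[of x] by (simp add: \<Phi>_def)
    next
      case 2
      then show ?thesis using R[of x] cov_zero_outside[OF R 2] by (simp add: \<Phi>_def P_def)
    qed
  qed
  \<comment> \<open>With r^(2 - d) alone as weight the energy would drop out altogether; the cutoff
    leaves -\<kappa> r^(2 - d) / 2 times it.\<close>
  define Ia where "Ia x = (\<theta> x * p2 x) * (magnetic_laplacian A w x \<bullet> D w x + (1 - ?d / 2) * energy w x)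
      + (\<theta> x * ((2 - ?d) * p2 x) + \<kappa> x * p2 x) * (D w x \<bullet> D w x / (norm x)\<^sup>2 - energy w x / 2)" for x
  have Ia: "has_bochner_integral lborel Ia 0"
    unfolding Ia_def
    by (rule integral_dilation[OF w radial_weight_mult[OF rw(1) rp(2)] e _ _ R]) (use z p0 in auto)
  define Ib where "Ib x = (\<kappa> x * p2 x) * (magnetic_laplacian A w x \<bullet> w x + energy w x)
      + (\<kappa> x * ((2 - ?d) * p2 x) + \<kappa>' x * p2 x) / (norm x)\<^sup>2 * (D w x \<bullet> w x)" for x
  have Ib: "has_bochner_integral lborel Ib 0"
    unfolding Ib_def
    by (rule integral_energy[OF w radial_weight_mult[OF rw(2) rp(2)] e _ R]) (use z in auto)
  \<comment> \<open>The factor r^(-d) cancels the dimensional term of the divergence, so the pairing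
    of \<open>D w\<close> with \<open>w\<close> is traded for the radial derivative of the remaining
    weight. It is used for \<theta>, \<kappa> and \<kappa>' in turn.\<close>
  define Ic where "Ic f f' x = (?d * (f x * p x) + (f x * (- ?d * p x) + f' x * p x)) * (w x \<bullet> w x)
      + 2 * (f x * p x) * (D w x \<bullet> w x)" for f f' x
  have Ic: "has_bochner_integral lborel (Ic f f') 0"
    if "radial_weight f f'" "\<And>x. norm x < e \<Longrightarrow> f x = 0" for f f'
    unfolding Ic_def[abs_def]
    by (rule integral_radial[OF w1 radial_weight_mult[OF that(1) rp(1)] e _ _ R]) (use that(2) p0 in auto)
  define Id where "Id x = (?d * (\<theta> x * p2 x) + (\<theta> x * ((2 - ?d) * p2 x) + \<kappa> x * p2 x)) * (w x \<bullet> w x)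
      + 2 * (\<theta> x * p2 x) * (D w x \<bullet> w x)" for x
  have Id: "has_bochner_integral lborel Id 0"
    unfolding Id_def
    by (rule integral_radial[OF w1 radial_weight_mult[OF rw(1) rp(2)] e _ _ R]) (use z p0 in auto)
  \<comment> \<open>The cutoff is placed inside \<open>h\<close>, so that \<open>q\<close>
    multiplies a complete derivative along x and is never differentiated itself.\<close>
  define h where "h x = \<theta> x * (w x \<bullet> w x)" for x
  have h: "Ck_on 1 (- {0}) h" unfolding h_def
    by (intro Ck_on_1_mult Ck_on_1_inner w1 radial_weightD(1)[OF rw(1)])
  define Ie where "Ie x = p x * q x * (\<Sum>j\<in>UNIV. x $ j * partial j h x)" for x
  have Ie: "integrable lborel Ie" "(LINT x|lborel. Ie x) \<le> 0"
    unfolding Ie_def p_def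
    by (rule integral_radial_monotone[OF q mono h _ e, where R = R]; use nonneg z R in \<open>simp add: h_def\<close>)+
  have Ie_eq: "Ie x = p x * q x * (2 * \<theta> x * (D w x \<bullet> w x) + \<kappa> x * (w x \<bullet> w x))" if x: "x \<noteq> 0" for x
  proof -
    have dw: "w differentiable (at x)" using Ck_on_differentiable[OF w1] x by simp
    note dh = differentiable_bilinear[OF bounded_bilinear_inner dw dw]
    have sq: "(\<Sum>j\<in>UNIV. x $ j * x $ j) = (norm x)\<^sup>2"
      by (simp add: power2_norm_eq_inner inner_vec_def)
    have "(\<Sum>j\<in>UNIV. x $ j * partial j h x)
        = (\<Sum>j\<in>UNIV. x $ j * (\<theta> x * (2 * (E j w x \<bullet> w x))) + x $ j * x $ j * (\<kappa> x * (w x \<bullet> w x) / (norm x)\<^sup>2))"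
      unfolding h_def partial_bilinear[OF bounded_bilinear_mult radial_weightD(2)[OF rw(1) x] dh]
        radial_weightD(3)[OF rw(1) x] cov_leibniz[OF dw dw, where A=A]
      by (simp add: inner_commute algebra_simps)
    also have "\<dots> = 2 * \<theta> x * (D w x \<bullet> w x) + \<kappa> x * (w x \<bullet> w x)"
      unfolding sum.distrib sum_distrib_right[symmetric] sq
      using x by (simp add: dilation_def inner_sum_left sum_distrib_left mult_ac)
    finally show ?thesis by (simp add: Ie_def)
  qed
  define S where "S x = - 4 * \<tau> * Ia x - 2 * \<tau> * Ib x - 2 * \<tau> * c * Ic \<theta> \<kappa> x + 2 * \<tau>\<^sup>2 * Ic \<kappa> \<kappa>' x
      + \<tau> * Ic \<kappa>' \<kappa>'' x - 2 * \<tau> * lam * Id x - 2 * \<tau> * Ie x" for x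
  \<comment> \<open>The value is left unevaluated so that it matches the shape of \<open>S\<close>
    summand by summand.\<close>
  have "has_bochner_integral lborel S (- 4 * \<tau> * 0 - 2 * \<tau> * 0 - 2 * \<tau> * c * 0 + 2 * \<tau>\<^sup>2 * 0
      + \<tau> * 0 - 2 * \<tau> * lam * 0 - 2 * \<tau> * (LINT x|lborel. Ie x))"
    unfolding S_def
    by (intro has_bochner_integral_add has_bochner_integral_diff has_bochner_integral_mult_right
        Ia Ib Ic Id rw has_bochner_integral_integrable Ie(1)) (use z in auto)
  then have S: "integrable lborel S" "(LINT x|lborel. S x) = - 2 * \<tau> * (LINT x|lborel. Ie x)"
    by (auto simp: has_bochner_integral_iff)
  \<comment> \<open>Only the squares are dropped here. The identity divides by r^2, so the origin is
    checked separately; both sides vanish there.\<close>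
  have "S x \<le> \<Phi> x" for x
  proof (cases "x = 0")
    case True
    then show ?thesis
      using z0 p0 by (simp add: S_def \<Phi>_def Ia_def Ib_def Ic_def Id_def Ie_def)
  next
    case False
    let ?X = "D w x"
    have "\<Phi> x = S x + p x * (\<theta> x * ((P x + (2 * \<tau>) *\<^sub>R ?X) \<bullet> (P x + (2 * \<tau>) *\<^sub>R ?X))
        + 4 * \<tau>\<^sup>2 * \<theta> x * (?X \<bullet> ?X) + 4 * \<tau> * \<kappa> x * (?X \<bullet> ?X))"
      unfolding \<Phi>_def S_def Ia_def Ib_def Ic_def Id_def Ie_eq[OF False] p2 p_def[symmetric]
      by (rule weighted_inequality_identity) (use False in \<open>auto simp: P_def\<close>)
    moreover have "p x * (\<theta> x * ((P x + (2 * \<tau>) *\<^sub>R ?X) \<bullet> (P x + (2 * \<tau>) *\<^sub>R ?X))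
        + 4 * \<tau>\<^sup>2 * \<theta> x * (?X \<bullet> ?X) + 4 * \<tau> * \<kappa> x * (?X \<bullet> ?X)) \<ge> 0"
      using tau by (intro mult_nonneg_nonneg add_nonneg_nonneg pnn nonneg inner_ge_zero) auto
    ultimately show ?thesis by linarith
  qed
  then have "(LINT x|lborel. S x) \<le> (LINT x|lborel. \<Phi> x)"
    by (intro integral_mono S int)
  moreover have "0 \<le> - 2 * \<tau> * (LINT x|lborel. Ie x)"
    using Ie(2) tau by (simp add: mult_nonneg_nonpos)
  ultimately show "0 \<le> (LINT x|lborel. \<Phi> x)" using S(2) by linarith
qed

end

subsection \<open>Cutoffs near the origin\<close>

text \<open>
  Away from the origin this is $\max(0, 1 - e/|x|)$; at the origin, where \<open>e / norm x\<close> is \<open>0\<close>,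
  that formula would not vanish.
\<close>

definition cutoff :: "real \<Rightarrow> real ^ 'n::finite \<Rightarrow> real"
  where "cutoff e x = (if norm x \<le> e then 0 else 1 - e / norm x)"

lemma cutoff_bounds:
  assumes "e > 0"
  shows "0 \<le> cutoff e x" "cutoff e x \<le> 1" "norm x \<le> e \<Longrightarrow> cutoff e x = 0"
    "norm x > e \<Longrightarrow> 0 \<le> e / norm x \<and> e / norm x \<le> 1"
  using assms by (auto simp: cutoff_def divide_le_eq_1)

text \<open>The double successor enforces an exponent of at least two, which flattens the kink at 0
  enough for the derivative to exist there.\<close>

lemma DERIV_max_power:
  "((\<lambda>y :: real. max 0 y ^ Suc (Suc k)) has_real_derivative real (Suc (Suc k)) * max 0 y ^ Suc k) (at y)"
proof -
  consider "y > 0" | "y < 0" | "y = 0" by linarith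
  then show ?thesis
  proof cases
    case 1
    have "((\<lambda>y :: real. y ^ Suc (Suc k)) has_real_derivative real (Suc (Suc k)) * y ^ Suc k) (at y)"
      using DERIV_pow[of "Suc (Suc k)" y] by simp
    then have "((\<lambda>y :: real. max 0 y ^ Suc (Suc k)) has_real_derivative real (Suc (Suc k)) * y ^ Suc k) (at y)"
      by (rule has_field_derivative_transform_within_open[of _ _ _ "{0<..}"]) (use 1 in auto)
    then show ?thesis using 1 by simp
  next
    case 2
    have "((\<lambda>y :: real. 0) has_real_derivative 0) (at y)" by simp
    then have "((\<lambda>y :: real. max 0 y ^ Suc (Suc k)) has_real_derivative 0) (at y)"
      by (rule has_field_derivative_transform_within_open[of _ _ _ "{..<0}"]) (use 2 in auto)
    then show ?thesis using 2 by simp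
  next
    case 3
    have "((\<lambda>h :: real. max 0 h ^ Suc (Suc k) / h) \<longlongrightarrow> 0) (at 0)"
    proof (rule Lim_null_comparison[of _ "\<lambda>h. \<bar>h\<bar> ^ Suc k"])
      have "norm (max 0 h ^ Suc (Suc k) / h) \<le> \<bar>h\<bar> ^ Suc k" for h :: real
        using mult_nonpos_nonneg[of h "(- h) ^ k"] by (cases "h > 0") auto
      then show "\<forall>\<^sub>F h in at 0. norm (max 0 h ^ Suc (Suc k) / h) \<le> \<bar>h :: real\<bar> ^ Suc k"
        by simp
      show "((\<lambda>h. \<bar>h :: real\<bar> ^ Suc k) \<longlongrightarrow> 0) (at 0)" by (auto intro!: tendsto_eq_intros)
    qed
    then show ?thesis using 3 by (simp add: DERIV_def)
  qed
qed

lemma radial_weight_inverse_norm: "radial_weight (\<lambda>x. e / norm x) (\<lambda>x. - (e / norm x))"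
proof -
  have "radial_weight (\<lambda>x. e / norm x) (\<lambda>x. norm x * (- e / (norm x)\<^sup>2))"
    by (rule radial_weight_norm[of "\<lambda>r. e / r" "\<lambda>r. - e / r\<^sup>2"])
       (auto intro!: derivative_eq_intros continuous_intros simp: power2_eq_square)
  then show ?thesis by (rule radial_weight_cong) (auto simp: power2_eq_square)
qed

lemma radial_weight_cutoff_power:
  assumes e: "e > 0"
  shows "radial_weight (\<lambda>x. cutoff e x ^ Suc (Suc k)) (\<lambda>x. real (Suc (Suc k)) * cutoff e x ^ Suc k * (e / norm x))"
proof -
  have "radial_weight (\<lambda>x. max 0 (1 - e / norm x) ^ Suc (Suc k))
     (\<lambda>x. norm x * (real (Suc (Suc k)) * max 0 (1 - e / norm x) ^ Suc k * (e / (norm x)\<^sup>2)))"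
  proof (rule radial_weight_norm[of "\<lambda>r. max 0 (1 - e / r) ^ Suc (Suc k)"
      "\<lambda>r. real (Suc (Suc k)) * max 0 (1 - e / r) ^ Suc k * (e / r\<^sup>2)"])
    fix r :: real assume r: "r > 0"
    have "((\<lambda>r. 1 - e / r) has_real_derivative e / r\<^sup>2) (at r)"
      using r by (auto intro!: derivative_eq_intros simp: power2_eq_square)
    from DERIV_chain2[OF DERIV_max_power this]
    show "((\<lambda>r. max 0 (1 - e / r) ^ Suc (Suc k)) has_real_derivative
        real (Suc (Suc k)) * max 0 (1 - e / r) ^ Suc k * (e / r\<^sup>2)) (at r)" .
  qed (auto intro!: continuous_intros)
  then show ?thesis
  proof (rule radial_weight_cong)
    fix x :: "real ^ 'n::finite" assume x: "x \<noteq> 0"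
    have "max 0 (1 - e / norm x) = cutoff e x" using x e by (auto simp: cutoff_def max_def field_simps)
    then show "max 0 (1 - e / norm x) ^ Suc (Suc k) = cutoff e x ^ Suc (Suc k)"
      "norm x * (real (Suc (Suc k)) * max 0 (1 - e / norm x) ^ Suc k * (e / (norm x)\<^sup>2))
        = real (Suc (Suc k)) * cutoff e x ^ Suc k * (e / norm x)"
      using x by (simp_all only:) (simp add: power2_eq_square)
  qed
qed

lemma cutoff_eq_max: "e > 0 \<Longrightarrow> x \<noteq> 0 \<Longrightarrow> cutoff e x = max 0 (1 - e / norm x)"
  by (auto simp: cutoff_def max_def field_simps)

lemma continuous_cutoff:
  assumes "e > 0"
  shows "continuous_on (- {0}) (cutoff e)"
proof -
  have "continuous_on (- {0}) (\<lambda>x :: real ^ 'n. max 0 (1 - e / norm x))"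
    by (intro continuous_intros) auto
  then show ?thesis by (rule continuous_on_eq) (simp add: cutoff_eq_max assms)
qed

text \<open>Each of the following functions is $x\cdot\nabla$ of its predecessor.\<close>

definition cutoff0 :: "real \<Rightarrow> real ^ 'n::finite \<Rightarrow> real"
  where "cutoff0 e x = cutoff e x ^ 4"
definition cutoff1 :: "real \<Rightarrow> real ^ 'n::finite \<Rightarrow> real"
  where "cutoff1 e x = 4 * (e / norm x * cutoff e x ^ 3)"
definition cutoff2 :: "real \<Rightarrow> real ^ 'n::finite \<Rightarrow> real"
  where "cutoff2 e x = - 4 * (e / norm x * cutoff e x ^ 3) + 12 * ((e / norm x)\<^sup>2 * (cutoff e x)\<^sup>2)"
definition cutoff3 :: "real \<Rightarrow> real ^ 'n::finite \<Rightarrow> real"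
  where "cutoff3 e x = 4 * (e / norm x * cutoff e x ^ 3) - 36 * ((e / norm x)\<^sup>2 * (cutoff e x)\<^sup>2)
    + 24 * ((e / norm x) ^ 3 * cutoff e x)"

lemmas cutoff_defs = cutoff0_def cutoff1_def cutoff2_def cutoff3_def

text \<open>Differentiation along x sends e / r to its negative and lowers the power of the positive
  part by one. Starting from the fourth power, \<open>cutoff2\<close> still contains a square and is
  continuously differentiable, while \<open>cutoff3\<close> is merely continuous; this is where the
  exponent four comes from.\<close>

lemma radial_weight_cutoff:
  assumes e: "e > 0"
  shows "radial_weight (cutoff0 e) (cutoff1 e)" "radial_weight (cutoff1 e) (cutoff2 e)" "radial_weight (cutoff2 e) (cutoff3 e)"
proof -
  note s = radial_weight_inverse_norm[of e]
  note m2 = radial_weight_cutoff_power[OF e, of 0] and m3 = radial_weight_cutoff_power[OF e, of 1]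
  have a: "radial_weight (\<lambda>x. e / norm x * cutoff e x ^ 3)
      (\<lambda>x. - (e / norm x * cutoff e x ^ 3) + 3 * ((e / norm x)\<^sup>2 * (cutoff e x)\<^sup>2))"
    by (rule radial_weight_cong[OF radial_weight_mult[OF s m3]])
       (simp_all add: numeral_eq_Suc One_nat_def algebra_simps)
  have b: "radial_weight (\<lambda>x. (e / norm x)\<^sup>2 * (cutoff e x)\<^sup>2)
      (\<lambda>x. - 2 * ((e / norm x)\<^sup>2 * (cutoff e x)\<^sup>2) + 2 * ((e / norm x) ^ 3 * cutoff e x))"
    by (rule radial_weight_cong[OF radial_weight_mult[OF radial_weight_mult[OF s s] m2]])
       (simp_all add: numeral_eq_Suc One_nat_def algebra_simps)
  show "radial_weight (cutoff0 e) (cutoff1 e)"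
    by (rule radial_weight_cong[OF radial_weight_cutoff_power[OF e, of 2]])
       (simp_all add: cutoff_defs numeral_eq_Suc One_nat_def algebra_simps)
  show "radial_weight (cutoff1 e) (cutoff2 e)"
    by (rule radial_weight_cong[OF radial_weight_cmult[OF a, of 4]]) (simp_all add: cutoff_defs algebra_simps)
  show "radial_weight (cutoff2 e) (cutoff3 e)"
    by (rule radial_weight_cong[OF radial_weight_add[OF radial_weight_cmult[OF a, of "-4"] radial_weight_cmult[OF b, of 12]]])
       (simp_all add: cutoff_defs algebra_simps)
qed

text \<open>The cutoffs for different \<open>e\<close> are dilates of one profile, and
  differentiation along x commutes with dilations; so the bounds do not depend on \<open>e\<close>,
  as dominated convergence demands. The constants are sums of absolute coefficients: 4, 4 + 12 and 4
  + 36 + 24.\<close>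

lemma cutoff_bounds_all:
  assumes e: "e > 0"
  shows "0 \<le> cutoff0 e x" "cutoff0 e x \<le> 1" "0 \<le> cutoff1 e x" "cutoff1 e x \<le> 4"
    "\<bar>cutoff2 e x\<bar> \<le> 16" "\<bar>cutoff3 e x\<bar> \<le> 64"
    "norm x < e \<Longrightarrow> cutoff0 e x = 0 \<and> cutoff1 e x = 0 \<and> cutoff2 e x = 0 \<and> cutoff3 e x = 0"
proof -
  have m: "0 \<le> cutoff e x" "cutoff e x \<le> 1" using cutoff_bounds[OF e] by auto
  have s: "0 \<le> e / norm x" using e by simp
  \<comment> \<open>One factor \<open>cutoff e x\<close> must be present: it vanishes where
    \<open>e / norm x\<close> may exceed 1.\<close>
  have sm: "0 \<le> (e / norm x) ^ a * cutoff e x ^ Suc b \<and> (e / norm x) ^ a * cutoff e x ^ Suc b \<le> 1" for a b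
  proof (cases "norm x \<le> e")
    case False
    then have "e / norm x \<le> 1" using cutoff_bounds(4)[OF e, of x] by simp
    then show ?thesis using s m by (intro conjI mult_nonneg_nonneg mult_le_one power_le_one zero_le_power)
  qed (simp add: cutoff_def)
  have b: "0 \<le> e / norm x * cutoff e x ^ 3" "e / norm x * cutoff e x ^ 3 \<le> 1"
    "0 \<le> (e / norm x)\<^sup>2 * (cutoff e x)\<^sup>2" "(e / norm x)\<^sup>2 * (cutoff e x)\<^sup>2 \<le> 1"
    "0 \<le> (e / norm x) ^ 3 * cutoff e x" "(e / norm x) ^ 3 * cutoff e x \<le> 1"
    using sm[of 1 2] sm[of 2 1] sm[of 3 0] by (simp_all add: power2_eq_square)
  show "0 \<le> cutoff0 e x" "cutoff0 e x \<le> 1" using m by (auto simp: cutoff0_def power_le_one)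
  show "0 \<le> cutoff1 e x" "cutoff1 e x \<le> 4" "\<bar>cutoff2 e x\<bar> \<le> 16" "\<bar>cutoff3 e x\<bar> \<le> 64"
    unfolding cutoff_defs using b by linarith+
  show "norm x < e \<Longrightarrow> cutoff0 e x = 0 \<and> cutoff1 e x = 0 \<and> cutoff2 e x = 0 \<and> cutoff3 e x = 0"
    by (simp add: cutoff_defs cutoff_def)
qed

lemma continuous_cutoff3: "e > 0 \<Longrightarrow> continuous_on (- {0}) (cutoff3 e)"
  unfolding cutoff3_def[abs_def] by (intro continuous_intros continuous_cutoff) auto

lemma cutoff_tendsto:
  assumes x: "x \<noteq> 0"
  shows "(\<lambda>n. cutoff0 (inverse (real (Suc n))) x) \<longlonglongrightarrow> 1" "(\<lambda>n. cutoff1 (inverse (real (Suc n))) x) \<longlonglongrightarrow> 0"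
    "(\<lambda>n. cutoff2 (inverse (real (Suc n))) x) \<longlonglongrightarrow> 0" "(\<lambda>n. cutoff3 (inverse (real (Suc n))) x) \<longlonglongrightarrow> 0"
proof -
  let ?e = "\<lambda>n. inverse (real (Suc n))"
  have s: "(\<lambda>n. ?e n / norm x) \<longlonglongrightarrow> 0"
    using tendsto_divide[OF LIMSEQ_inverse_real_of_nat tendsto_const, of "norm x"] x by simp
  have "(\<lambda>n. max 0 (1 - ?e n / norm x)) \<longlonglongrightarrow> max 0 (1 - 0)"
    by (intro tendsto_intros s)
  then have m: "(\<lambda>n. cutoff (?e n) x) \<longlonglongrightarrow> 1" using x by (simp add: cutoff_eq_max)
  show "(\<lambda>n. cutoff0 (?e n) x) \<longlonglongrightarrow> 1" "(\<lambda>n. cutoff1 (?e n) x) \<longlonglongrightarrow> 0"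
    "(\<lambda>n. cutoff2 (?e n) x) \<longlonglongrightarrow> 0" "(\<lambda>n. cutoff3 (?e n) x) \<longlonglongrightarrow> 0"
    unfolding cutoff_defs by (rule tendsto_eq_intros s m refl | simp)+
qed

subsection \<open>A Hardy inequality\<close>

text \<open>The Hardy inequality concerns the ordinary gradient; regarding it as the case of zero
  potential makes \<open>integral_radial\<close> applicable.\<close>

lemma transversal_field_zero: "transversal_field (\<lambda>x. 0)"
  by unfold_locales (simp_all add: Ck_on_1_const B_tangential_def magnetic_field_def vec_eq_iff)

text \<open>Integrating the divergence of r^(2 \<tau> - 2) |u|^2 x and completing a square bounds
  the integral by that of r^(2 \<tau> - 2) |X|^2, where X is the derivative of \<open>u\<close>
  along x. The ordinary gradient is bounded, so |X| is at most a multiple of r and that integrand is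
  bounded with compact support. A covariant derivative would give no such bound for singular
  \<open>A\<close>.\<close>

lemma hardy_integrable:
  fixes u :: "real ^ 'n::finite \<Rightarrow> complex"
  assumes u: "Ck_on 1 UNIV u" and R: "\<And>x. norm x > R \<Longrightarrow> u x = 0"
    and tau: "\<tau> \<ge> 0" and a: "real CARD('n) - 2 + 2 * \<tau> > 0"
  shows "integrable lborel (\<lambda>x. norm x powr (2 * \<tau> - 2) * (u x \<bullet> u x))"
proof -
  interpret Z: transversal_field "\<lambda>x :: real ^ 'n. 0" by (rule transversal_field_zero)
  define a where "a = real CARD('n) - 2 + 2 * \<tau>"
  have a0: "a > 0" using assms by (simp add: a_def)
  define p where "p x = norm x powr (2 * \<tau> - 2)" for x :: "real ^ 'n"
  have rp: "radial_weight p (\<lambda>x. (2 * \<tau> - 2) * p x)" unfolding p_def[abs_def] by (rule radial_weight_powr)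
  have p0: "p 0 = 0" "p x \<ge> 0" for x by (auto simp: p_def)
  have u': "Ck_on 1 (- {0}) u" using u by (rule Ck_on_subset) simp
  have cu: "continuous_on S u" for S using Ck_on_continuous[OF u] continuous_on_subset by blast
  define X where "X x = Z.D u x" for x
  have X: "X x = (\<Sum>k\<in>UNIV. x $ k *\<^sub>R partial k u x)" for x
    by (simp add: X_def dilation_def cov_deriv_def)
  have X0: "X x = 0" if "norm x > R" for x
    unfolding X_def by (rule Z.cov_zero_outside(2)[OF R that])
  have "\<exists>M. \<forall>x \<in> cball 0 R. (\<Sum>k\<in>UNIV. norm (partial k u x)) \<le> M"
  proof -
    have "continuous_on (cball 0 R) (\<lambda>x. \<Sum>k\<in>UNIV. norm (partial k u x))"
      using u by (intro continuous_intros) (auto simp: Ck_on_1_iff intro: continuous_on_subset)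
    then have "compact ((\<lambda>x. \<Sum>k\<in>UNIV. norm (partial k u x)) ` cball 0 R)"
      by (intro compact_continuous_image) auto
    then have "bdd_above ((\<lambda>x. \<Sum>k\<in>UNIV. norm (partial k u x)) ` cball 0 R)"
      by (intro bounded_imp_bdd_above compact_imp_bounded)
    then show ?thesis unfolding bdd_above_def by auto
  qed
  then obtain M where M: "\<And>x. norm x \<le> R \<Longrightarrow> (\<Sum>k\<in>UNIV. norm (partial k u x)) \<le> M"
    by (metis mem_cball_0)
  have Xb: "norm (X x) \<le> norm x * M" if "norm x \<le> R" for x
  proof -
    have "norm (X x) \<le> (\<Sum>k\<in>UNIV. norm x * norm (partial k u x))"
      unfolding X by (rule sum_norm_le) (simp add: component_le_norm_cart mult_right_mono)
    also have "\<dots> \<le> norm x * M"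
      unfolding sum_distrib_left[symmetric] using M[OF that] by (intro mult_left_mono) auto
    finally show ?thesis .
  qed
  \<comment> \<open>The product in parentheses bounds \<open>p x * (X x \<bullet> X x)\<close>; the
    factor \<open>2 / a\<close> is left over from completing the square below.\<close>
  define K where "K = 2 / a * (R powr (2 * \<tau>) * M\<^sup>2)"
  have Xp: "2 / a * (p x * (X x \<bullet> X x)) \<le> K * indicator (cball 0 R) x" for x
  proof (cases "norm x \<le> R")
    case True
    have "p x * (X x \<bullet> X x) \<le> R powr (2 * \<tau>) * M\<^sup>2"
    proof (cases "x = 0")
      case False
      have "X x \<bullet> X x \<le> (norm x * M)\<^sup>2"
        unfolding power2_norm_eq_inner[symmetric] using Xb[OF True] by (intro power_mono) auto
      then have "p x * (X x \<bullet> X x) \<le> p x * (norm x * M)\<^sup>2" using p0 by (intro mult_left_mono)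
      also have "\<dots> = norm x powr (2 * \<tau>) * M\<^sup>2"
        using False by (simp add: p_def powr_diff power_mult_distrib)
      also have "\<dots> \<le> R powr (2 * \<tau>) * M\<^sup>2"
        using True tau by (intro mult_right_mono powr_mono2) auto
      finally show ?thesis .
    qed (simp add: p0)
    then show ?thesis using True a0 by (simp add: K_def divide_right_mono)
  qed (simp add: X0)
  let ?e = "\<lambda>n. inverse (real (Suc n))"
  \<comment> \<open>The right-hand side does not depend on \<open>n\<close>, so Fatou's lemma can
    remove the cutoff.\<close>
  have bound: "(\<integral>\<^sup>+x. ennreal (cutoff0 (?e n) x * p x * (u x \<bullet> u x)) \<partial>lborel)
      \<le> ennreal (2 / a * (LINT x|lborel. K * indicator (cball (0 :: real ^ 'n) R) x))" for n
  proof -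
    have e: "?e n > 0" by simp
    note cb = cutoff_bounds_all[OF e]
    define I where "I x = (CARD('n) * (cutoff0 (?e n) x * p x) + (cutoff0 (?e n) x * ((2 * \<tau> - 2) * p x) + cutoff1 (?e n) x * p x)) * (u x \<bullet> u x)
        + 2 * (cutoff0 (?e n) x * p x) * (X x \<bullet> u x)" for x
    have I: "has_bochner_integral lborel I 0"
      unfolding I_def X_def
      by (rule Z.integral_radial[OF u' radial_weight_mult[OF radial_weight_cutoff(1)[OF e] rp] e _ _ R])
         (use cb(7) p0 in auto)
    have iK: "integrable lborel (\<lambda>x :: real ^ 'n. K * indicator (cball 0 R) x)"
      by (intro integrable_mult_right integrable_real_indicator)
         (auto simp: emeasure_bounded_finite[OF bounded_cball, unfolded infinity_ennreal_def])
    have le: "cutoff0 (?e n) x * p x * (u x \<bullet> u x) \<le> 2 / a * (I x + K * indicator (cball 0 R) x)" for x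
    proof -
      let ?t = "cutoff0 (?e n) x * p x"
      have t: "0 \<le> ?t" "?t \<le> p x" using cb(1,2)[of x] p0(2)[of x] by (auto intro: mult_left_le_one_le)
      \<comment> \<open>The multiple \<open>a / 2\<close> is such that half of the main term absorbs
        the mixed term and the other half survives.\<close>
      have "0 \<le> ?t * (((a / 2) *\<^sub>R u x + X x) \<bullet> ((a / 2) *\<^sub>R u x + X x))"
        by (intro mult_nonneg_nonneg t inner_ge_zero)
      also have "\<dots> = (a / 2) * (a / 2 * (?t * (u x \<bullet> u x)) + 2 * ?t * (X x \<bullet> u x)) + ?t * (X x \<bullet> X x)"
        by (simp add: inner_add_left inner_add_right inner_commute[of "u x" "X x"] algebra_simps)
      finally have "0 \<le> 2 / a * ((a / 2) * (a / 2 * (?t * (u x \<bullet> u x)) + 2 * ?t * (X x \<bullet> u x)) + ?t * (X x \<bullet> X x))"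
        using a0 by simp
      also have "\<dots> = a / 2 * (?t * (u x \<bullet> u x)) + 2 * ?t * (X x \<bullet> u x) + 2 / a * (?t * (X x \<bullet> X x))"
        using a0 by (simp add: distrib_left)
      finally have 1: "- (2 * ?t * (X x \<bullet> u x)) \<le> a / 2 * (?t * (u x \<bullet> u x)) + 2 / a * (?t * (X x \<bullet> X x))"
        by linarith
      have "2 / a * (?t * (X x \<bullet> X x)) \<le> 2 / a * (p x * (X x \<bullet> X x))"
        using t a0 by (intro mult_left_mono mult_right_mono) auto
      then have 2: "2 / a * (?t * (X x \<bullet> X x)) \<le> K * indicator (cball 0 R) x" using Xp[of x] by linarith
      \<comment> \<open>The cutoff increases with the radius, so the boundary term has a good sign
        and is discarded.\<close>
      have "0 \<le> cutoff1 (?e n) x * p x * (u x \<bullet> u x)"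
        by (intro mult_nonneg_nonneg cb(3) p0(2) inner_ge_zero)
      moreover have "I x = a * (?t * (u x \<bullet> u x)) + cutoff1 (?e n) x * p x * (u x \<bullet> u x) + 2 * ?t * (X x \<bullet> u x)"
        by (simp add: I_def a_def algebra_simps)
      ultimately have "a / 2 * (?t * (u x \<bullet> u x)) \<le> I x + K * indicator (cball 0 R) x"
        using 1 2 by linarith
      then have "2 / a * (a / 2 * (?t * (u x \<bullet> u x))) \<le> 2 / a * (I x + K * indicator (cball 0 R) x)"
        using a0 by (intro mult_left_mono) auto
      then show ?thesis using a0 by simp
    qed
    have nn: "0 \<le> 2 / a * (I x + K * indicator (cball 0 R) x)" for x
      by (rule order_trans[OF _ le]) (intro mult_nonneg_nonneg cb(1) p0(2) inner_ge_zero)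
    have "(\<integral>\<^sup>+x. ennreal (cutoff0 (?e n) x * p x * (u x \<bullet> u x)) \<partial>lborel)
        \<le> (\<integral>\<^sup>+x. ennreal (2 / a * (I x + K * indicator (cball 0 R) x)) \<partial>lborel)"
      by (intro nn_integral_mono ennreal_leI le)
    also have "\<dots> = ennreal (LINT x|lborel. 2 / a * (I x + K * indicator (cball 0 R) x))"
      using I iK nn by (intro nn_integral_eq_integral) (auto simp: has_bochner_integral_iff)
    also have "(LINT x|lborel. 2 / a * (I x + K * indicator (cball 0 R) x))
        = 2 / a * (LINT x|lborel. K * indicator (cball (0 :: real ^ 'n) R) x)"
      using I iK by (subst integral_mult_right_zero, subst Bochner_Integration.integral_add) (auto simp: has_bochner_integral_iff)
    finally show ?thesis .
  qed
  have cutoff0_m: "cutoff0 (?e n) \<in> borel_measurable borel" for n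
    by (rule borel_measurable_punctured)
       (rule Ck_on_continuous[OF radial_weightD(1)[OF radial_weight_cutoff(1)]], simp)
  have um: "u \<in> borel_measurable borel" using cu by (rule borel_measurable_continuous_onI)
  have pm: "p \<in> borel_measurable borel" unfolding p_def by measurable
  note [measurable] = cutoff0_m um pm
  have lim: "(\<lambda>n. ennreal (cutoff0 (?e n) x * p x * (u x \<bullet> u x))) \<longlonglongrightarrow> ennreal (p x * (u x \<bullet> u x))" for x
  proof (cases "x = 0")
    case False
    have "(\<lambda>n. cutoff0 (?e n) x * p x * (u x \<bullet> u x)) \<longlonglongrightarrow> 1 * p x * (u x \<bullet> u x)"
      by (intro tendsto_intros cutoff_tendsto False)
    then show ?thesis by (intro tendsto_ennrealI) simp
  qed (simp add: p0)
  have "(\<integral>\<^sup>+x. ennreal (p x * (u x \<bullet> u x)) \<partial>lborel)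
      = (\<integral>\<^sup>+x. liminf (\<lambda>n. ennreal (cutoff0 (?e n) x * p x * (u x \<bullet> u x))) \<partial>lborel)"
    by (intro nn_integral_cong lim_imp_Liminf[symmetric] lim) simp
  also have "\<dots> \<le> liminf (\<lambda>n. \<integral>\<^sup>+x. ennreal (cutoff0 (?e n) x * p x * (u x \<bullet> u x)) \<partial>lborel)"
    by (intro nn_integral_liminf) measurable
  also have "\<dots> \<le> ennreal (2 / a * (LINT x|lborel. K * indicator (cball (0 :: real ^ 'n) R) x))"
    by (rule Liminf_le) (use bound in auto)
  also have "\<dots> < \<infinity>" by simp
  finally have "integrable lborel (\<lambda>x. p x * (u x \<bullet> u x))"
    using p0 by (intro integrableI_nonneg) auto
  then show ?thesis by (simp add: p_def)
qed

subsection \<open>Conjugation by a power of the norm\<close>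

lemma Ck_on_2_scaleR:
  assumes S: "open S" and f: "Ck_on 2 S f" and g: "Ck_on 2 S g"
  shows "Ck_on 2 S (\<lambda>y. f y *\<^sub>R g y)"
  unfolding Ck_on_2_iff
proof (intro conjI ballI allI)
  have d: "f differentiable (at x)" "g differentiable (at x)" if "x \<in> S" for x
    using f g that by (auto simp: Ck_on_2_iff)
  note f1 = Ck_on_2_imp_1[OF f]
    and g1 = Ck_on_2_imp_1[OF g]
  show "(\<lambda>y. f y *\<^sub>R g y) differentiable (at x)" if "x \<in> S" for x
    by (rule differentiable_bilinear[OF bounded_bilinear_scaleR d[OF that]])
  show "Ck_on 1 S (partial j (\<lambda>y. f y *\<^sub>R g y))" for j
  proof (rule Ck_on_1_cong[OF S])
    show "f y *\<^sub>R partial j g y + partial j f y *\<^sub>R g y = partial j (\<lambda>y. f y *\<^sub>R g y) y" if "y \<in> S" for y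
      using partial_bilinear[OF bounded_bilinear_scaleR d[OF that]] by simp
    show "Ck_on 1 S (\<lambda>y. f y *\<^sub>R partial j g y + partial j f y *\<^sub>R g y)"
      using f g by (intro Ck_on_1_add Ck_on_1_scaleR f1 g1) (auto simp: Ck_on_2_iff)
  qed
qed

lemma partial_norm_powr:
  fixes x :: "real ^ 'n::finite"
  assumes "x \<noteq> 0"
  shows "partial j (\<lambda>y. norm y powr b) x = x $ j * (b * norm x powr (b - 2))"
  using radial_weightD(3)[OF radial_weight_powr assms, of j b] assms by (simp add: powr_diff)

lemma Ck_on_2_norm_powr: "Ck_on 2 (- {0}) (\<lambda>y :: real ^ 'n::finite. norm y powr b)"
  unfolding Ck_on_2_iff
proof (intro conjI ballI allI)
  fix j :: 'n
  have "Ck_on 1 (- {0}) (\<lambda>x. x $ j * (b * norm x powr (b - 2)))"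
    by (intro Ck_on_1_mult Ck_on_1_component Ck_on_1_const radial_weightD(1)[OF radial_weight_powr])
  then show "Ck_on 1 (- {0}) (partial j (\<lambda>y. norm y powr b))"
    by (rule Ck_on_1_cong[OF open_punctured, rotated]) (simp add: partial_norm_powr)
qed (use radial_weightD(2)[OF radial_weight_powr] in auto)

context transversal_field
begin

text \<open>Off the origin the Laplacian of r^b is b (b + d - 2) r^(b - 2), and the gradient of r^b
  is b r^(b - 2) x, which turns the mixed term into the dilation derivative. The potential acts on
  \<open>u\<close> only, so the formulas are those of the free case.\<close>

lemma conjugation:
  fixes b :: real
  assumes u: "Ck_on 2 (- {0}) u" and x: "x \<noteq> 0"
  defines "w \<equiv> \<lambda>y. norm y powr b *\<^sub>R u y"
  shows "D w x = norm x powr b *\<^sub>R (D u x + b *\<^sub>R u x)"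
    and "(norm x)\<^sup>2 *\<^sub>R magnetic_laplacian A w x = norm x powr b *\<^sub>R
      ((norm x)\<^sup>2 *\<^sub>R magnetic_laplacian A u x + (2 * b) *\<^sub>R D u x + (b * (b + real CARD('n) - 2)) *\<^sub>R u x)"
proof -
  let ?p = "\<lambda>b y :: real ^ 'n. norm y powr b"
  have dp: "?p c differentiable (at y)" if "y \<noteq> 0" for c y using radial_weightD(2)[OF radial_weight_powr that] .
  have du: "u differentiable (at y)" if "y \<noteq> 0" for y using u that by (auto simp: Ck_on_2_iff)
  have dE: "E j u differentiable (at y)" if "y \<noteq> 0" for j y using Ck_on_differentiable[OF Ck_on_cov[OF u]] that by auto
  have Ew: "E j w y = ?p b y *\<^sub>R E j u y + (y $ j * (b * ?p (b - 2) y)) *\<^sub>R u y" if "y \<noteq> 0" for j y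
    unfolding w_def cov_scaleR[OF dp[OF that] du[OF that]] partial_norm_powr[OF that] ..
  have sub2: "?p c x = (norm x)\<^sup>2 * ?p (c - 2) x" for c using x by (simp add: powr_diff)
  note N = sub2[of b] and N' = sub2[of "b - 2"]
  have sq: "(\<Sum>j\<in>UNIV. x $ j * x $ j) = (norm x)\<^sup>2"
    by (simp add: power2_norm_eq_inner inner_vec_def)
  have "D w x = (\<Sum>j\<in>UNIV. ?p b x *\<^sub>R (x $ j *\<^sub>R E j u x) + (x $ j * x $ j) *\<^sub>R ((b * ?p (b - 2) x) *\<^sub>R u x))"
    unfolding dilation_def Ew[OF x] by (intro sum.cong) (simp_all add: scaleR_add_right mult_ac)
  also have "\<dots> = ?p b x *\<^sub>R D u x + (norm x)\<^sup>2 *\<^sub>R ((b * ?p (b - 2) x) *\<^sub>R u x)"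
    unfolding sum.distrib scaleR_sum_left[symmetric] sq dilation_def scaleR_sum_right ..
  finally show "D w x = norm x powr b *\<^sub>R (D u x + b *\<^sub>R u x)"
    by (simp add: N scaleR_add_right mult_ac)
  have d1: "(\<lambda>y. b * ?p (b - 2) y) differentiable (at x)"
    by (rule differentiable_linear[OF bounded_linear_mult_right dp[OF x]])
  note d2 = differentiable_bilinear[OF bounded_bilinear_mult differentiable_component d1]
  have pd: "partial j (\<lambda>y. y $ j * (b * ?p (b - 2) y)) x
      = b * ?p (b - 2) x + x $ j * x $ j * (b * (b - 2) * ?p (b - 2 - 2) x)" for j
    unfolding partial_bilinear[OF bounded_bilinear_mult differentiable_component d1]
      partial_linear[OF bounded_linear_mult_right dp[OF x]] partial_norm_powr[OF x] partial_component
    by (simp add: mult_ac)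
  have EE: "E j (E j w) x = ?p b x *\<^sub>R E j (E j u) x + (2 * b * ?p (b - 2) x) *\<^sub>R (x $ j *\<^sub>R E j u x)
      + (b * ?p (b - 2) x) *\<^sub>R u x + (x $ j * x $ j) *\<^sub>R ((b * (b - 2) * ?p (b - 2 - 2) x) *\<^sub>R u x)" for j
  proof -
    have "E j (E j w) x = E j (\<lambda>y. ?p b y *\<^sub>R E j u y + (y $ j * (b * ?p (b - 2) y)) *\<^sub>R u y) x"
      by (rule cov_cong[OF open_punctured]) (use x Ew in auto)
    also have "\<dots> = E j (\<lambda>y. ?p b y *\<^sub>R E j u y) x + E j (\<lambda>y. (y $ j * (b * ?p (b - 2) y)) *\<^sub>R u y) x"
      by (rule cov_add[OF differentiable_bilinear[OF bounded_bilinear_scaleR dp[OF x] dE[OF x]]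
            differentiable_bilinear[OF bounded_bilinear_scaleR d2 du[OF x]]])
    also have "\<dots> = ?p b x *\<^sub>R E j (E j u) x + (x $ j * (b * ?p (b - 2) x)) *\<^sub>R E j u x
        + ((x $ j * (b * ?p (b - 2) x)) *\<^sub>R E j u x
        + (b * ?p (b - 2) x + x $ j * x $ j * (b * (b - 2) * ?p (b - 2 - 2) x)) *\<^sub>R u x)"
      unfolding cov_scaleR[OF dp[OF x] dE[OF x]] cov_scaleR[OF d2 du[OF x]] pd partial_norm_powr[OF x] ..
    finally show ?thesis by (simp add: scaleR_conv_of_real algebra_simps)
  qed
  have "magnetic_laplacian A w x = (\<Sum>j\<in>UNIV. ?p b x *\<^sub>R E j (E j u) x
      + (2 * b * ?p (b - 2) x) *\<^sub>R (x $ j *\<^sub>R E j u x)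
      + (b * ?p (b - 2) x) *\<^sub>R u x + (x $ j * x $ j) *\<^sub>R ((b * (b - 2) * ?p (b - 2 - 2) x) *\<^sub>R u x))"
    unfolding magnetic_laplacian_def EE ..
  also have "\<dots> = ?p b x *\<^sub>R magnetic_laplacian A u x + (2 * b * ?p (b - 2) x) *\<^sub>R D u x
      + real CARD('n) *\<^sub>R ((b * ?p (b - 2) x) *\<^sub>R u x) + (norm x)\<^sup>2 *\<^sub>R ((b * (b - 2) * ?p (b - 2 - 2) x) *\<^sub>R u x)"
    unfolding magnetic_laplacian_def[of A u] dilation_def sum.distrib sq[symmetric] scaleR_sum_left
      scaleR_sum_right sum_constant_scaleR ..
  also have "(norm x)\<^sup>2 *\<^sub>R ((b * (b - 2) * ?p (b - 2 - 2) x) *\<^sub>R u x) = (b * (b - 2) * ?p (b - 2) x) *\<^sub>R u x"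
    by (simp add: N' mult_ac)
  finally have L: "magnetic_laplacian A w x = ?p b x *\<^sub>R magnetic_laplacian A u x + (2 * b * ?p (b - 2) x) *\<^sub>R D u x
      + real CARD('n) *\<^sub>R ((b * ?p (b - 2) x) *\<^sub>R u x) + (b * (b - 2) * ?p (b - 2) x) *\<^sub>R u x" .
  show "(norm x)\<^sup>2 *\<^sub>R magnetic_laplacian A w x = norm x powr b *\<^sub>R
      ((norm x)\<^sup>2 *\<^sub>R magnetic_laplacian A u x + (2 * b) *\<^sub>R D u x + (b * (b + real CARD('n) - 2)) *\<^sub>R u x)"
    unfolding L N by (simp add: scaleR_conv_of_real algebra_simps)
qed

end

subsection \<open>Removing the cutoff\<close>

context transversal_field
begin

lemma weighted_inequality_cutoff:
  fixes V :: "real ^ 'n \<Rightarrow> real" and \<tau> lam :: real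
  assumes u: "Ck_on 2 (- {0}) u" and R: "\<And>x. norm x > R \<Longrightarrow> u x = 0"
    and V: "continuous_on (- {0}) V"
    and mono: "\<And>x a. x \<noteq> 0 \<Longrightarrow> 0 < a \<Longrightarrow> a \<le> 1 \<Longrightarrow>
      (norm (a *\<^sub>R x))\<^sup>2 * V (a *\<^sub>R x) \<le> (norm x)\<^sup>2 * V x"
    and tau: "\<tau> \<ge> 0" and e: "e > 0"
  defines "F \<equiv> \<lambda>x. magnetic_laplacian A u x + of_real (V x) * u x + of_real lam * u x"
  defines "\<Phi> \<equiv> \<lambda>x. norm x powr (2 * \<tau> - 2) * (cutoff0 e x * (norm x ^ 4 * (F x \<bullet> F x))
      - 4 * \<tau> * lam * cutoff0 e x * (norm x)\<^sup>2 * (u x \<bullet> u x)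
      - 2 * \<tau> * cutoff1 e x * ((norm x)\<^sup>2 * (F x \<bullet> u x))
      + 2 * \<tau> * (\<tau> * cutoff2 e x + cutoff3 e x / 2) * (u x \<bullet> u x))"
  shows "integrable lborel \<Phi>" "0 \<le> (LINT x|lborel. \<Phi> x)"
proof -
  \<comment> \<open>This makes \<open>2 * \<alpha>\<close> equal to the coefficient d - 2 + 2 \<tau>
    of the first-order term, and 2 \<alpha> - d equal to 2 \<tau> - 2.\<close>
  define \<alpha> where "\<alpha> = \<tau> + (real CARD('n) - 2) / 2"
  define w where "w x = norm x powr \<alpha> *\<^sub>R u x" for x
  \<comment> \<open>Conjugation contributes -\<alpha> (\<alpha> + d - 2), and expressing r^\<alpha>
    \<open>D u\<close> through \<open>D w\<close> adds 2 \<alpha>^2; \<open>c\<close> is their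
    sum.\<close>
  define c where "c = \<alpha>\<^sup>2 - (real CARD('n) - 2) * \<alpha>"
  define q where "q x = (norm x)\<^sup>2 * V x" for x
  define P where "P x = (norm x)\<^sup>2 *\<^sub>R magnetic_laplacian A w x - (real CARD('n) - 2 + 2 * \<tau>) *\<^sub>R D w x
      + (c + q x + lam * (norm x)\<^sup>2) *\<^sub>R w x" for x
  have w2: "Ck_on 2 (- {0}) w" unfolding w_def
    by (rule Ck_on_2_scaleR[OF open_punctured Ck_on_2_norm_powr u])
  have wR: "w x = 0" if "norm x > R" for x using R[OF that] by (simp add: w_def)
  have q: "continuous_on (- {0}) q" unfolding q_def by (intro continuous_intros V)
  have qm: "q (a *\<^sub>R x) \<le> q x" if "x \<noteq> 0" "0 < a" "a \<le> 1" for x a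
    using mono[OF that] by (simp add: q_def)
  note wi = weighted_inequality[OF w2 wR radial_weight_cutoff[OF e] continuous_cutoff3[OF e]
      cutoff_bounds_all(1)[OF e] cutoff_bounds_all(3)[OF e] e cutoff_bounds_all(7)[OF e] q qm tau,
      where c = c and lam = lam, folded P_def]
  have PF: "P x = norm x powr \<alpha> *\<^sub>R ((norm x)\<^sup>2 *\<^sub>R F x)" if x: "x \<noteq> 0" for x
  proof -
    have 2: "real CARD('n) - 2 + 2 * \<tau> = 2 * \<alpha>" by (simp add: \<alpha>_def field_simps)
    have "P x = norm x powr \<alpha> *\<^sub>R ((norm x)\<^sup>2 *\<^sub>R magnetic_laplacian A u x + (2 * \<alpha>) *\<^sub>R D u x
         + (\<alpha> * (\<alpha> + real CARD('n) - 2)) *\<^sub>R u x - (2 * \<alpha>) *\<^sub>R (D u x + \<alpha> *\<^sub>R u x)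
         + (c + q x + lam * (norm x)\<^sup>2) *\<^sub>R u x)"
      unfolding P_def 2 w_def conjugation[OF u x]
      by (simp add: scaleR_add_right scaleR_diff_right mult_ac)
    also have "\<dots> = norm x powr \<alpha> *\<^sub>R ((norm x)\<^sup>2 *\<^sub>R F x)"
      by (rule arg_cong[where f = "\<lambda>z. norm x powr \<alpha> *\<^sub>R z"])
         (simp add: F_def c_def q_def scaleR_conv_of_real algebra_simps power2_eq_square)
    finally show ?thesis .
  qed
  have eq: "norm x powr (- real CARD('n)) * (cutoff0 e x * (P x \<bullet> P x)
       - 4 * \<tau> * lam * cutoff0 e x * (norm x)\<^sup>2 * (w x \<bullet> w x)
        - 2 * \<tau> * cutoff1 e x * (P x \<bullet> w x)
        + 2 * \<tau> * (\<tau> * cutoff2 e x + cutoff3 e x / 2) * (w x \<bullet> w x)) = \<Phi> x" for x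
  proof (cases "x = 0")
    case False
    have "norm x powr (2 * \<tau> - 2) = norm x powr (- real CARD('n)) * (norm x powr \<alpha> * norm x powr \<alpha>)"
      unfolding powr_add[symmetric] by (rule arg_cong2[where f = "(powr)"]) (simp_all add: \<alpha>_def field_simps)
    then show ?thesis
      unfolding \<Phi>_def PF[OF False] w_def inner_scaleR_left inner_scaleR_right
      by (simp add: algebra_simps power2_eq_square power4_eq_xxxx)
  qed (simp add: \<Phi>_def)
  show "integrable lborel \<Phi>" "0 \<le> (LINT x|lborel. \<Phi> x)"
    using wi[where R = R] unfolding eq by blast+
qed

text \<open>Finiteness of the right-hand side and the Hardy integrability of r^(2 \<tau> - 2) |u|^2
  dominate the cut-off integrands uniformly. In the limit the cutoff becomes 1 and its derivatives
  along x become 0, which leaves precisely the two integrals of the claim.\<close>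

lemma carleman_inequality:
  fixes V :: "real ^ 'n \<Rightarrow> real" and \<tau> lam :: real
  assumes u: "Ck_on 2 UNIV u" and R: "\<And>x. norm x > R \<Longrightarrow> u x = 0"
    and V: "continuous_on (- {0}) V"
    and mono: "\<And>x a. x \<noteq> 0 \<Longrightarrow> 0 < a \<Longrightarrow> a \<le> 1 \<Longrightarrow>
      (norm (a *\<^sub>R x))\<^sup>2 * V (a *\<^sub>R x) \<le> (norm x)\<^sup>2 * V x"
    and tau: "\<tau> > 0" and lam: "lam > 0" and dim: "real CARD('n) - 2 + 2 * \<tau> > 0"
  defines "F \<equiv> \<lambda>x. magnetic_laplacian A u x + of_real (V x) * u x + of_real lam * u x"
  assumes F: "integrable lborel (\<lambda>x. norm x powr (2 * \<tau> + 2) * (cmod (F x))\<^sup>2)"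
  shows "integrable lborel (\<lambda>x. norm x powr (2 * \<tau>) * (cmod (u x))\<^sup>2)"
    and "4 * \<tau> * lam * (LINT x|lborel. norm x powr (2 * \<tau>) * (cmod (u x))\<^sup>2)
      \<le> (LINT x|lborel. norm x powr (2 * \<tau> + 2) * (cmod (F x))\<^sup>2)"
proof -
  define p where "p x = norm x powr (2 * \<tau> - 2)" for x :: "real ^ 'n"
  define h where "h x = u x \<bullet> u x" for x
  define f where "f x = norm x ^ 4 * (F x \<bullet> F x)" for x
  have p0: "p 0 = 0" "p x \<ge> 0" for x by (auto simp: p_def)
  have h0: "h x \<ge> 0" for x by (simp add: h_def)
  have f0: "f x \<ge> 0" for x by (simp add: f_def)
  have pf: "norm x powr (2 * \<tau> + 2) * (cmod (F x))\<^sup>2 = p x * f x" for x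
  proof (cases "x = 0")
    case False
    then have "norm x powr (2 * \<tau> + 2) = p x * norm x ^ 4"
      by (simp add: p_def powr_add powr_diff field_simps flip: power_add)
    then show ?thesis by (simp add: f_def power2_norm_eq_inner)
  qed (simp add: p_def)
  have ph: "norm x powr (2 * \<tau>) * (cmod (u x))\<^sup>2 = p x * ((norm x)\<^sup>2 * h x)" for x
    by (cases "x = 0") (simp_all add: p_def h_def powr_diff power2_norm_eq_inner)
  have u1: "Ck_on 1 UNIV u" by (rule Ck_on_2_imp_1[OF u])
  have u2: "Ck_on 2 (- {0}) u"
    using u by (rule Ck_on_subset) simp
  have cu: "continuous_on S u" for S using Ck_on_continuous[OF u1] continuous_on_subset by blast
  have ip: "integrable lborel (\<lambda>x. p x * h x)"
    unfolding p_def h_def by (rule hardy_integrable[OF u1 R _ dim]) (use tau in auto)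
  have iF: "integrable lborel (\<lambda>x. p x * f x)" using F by (simp add: pf)
  have [measurable]: "u \<in> borel_measurable borel" "p \<in> borel_measurable borel" "F \<in> borel_measurable borel"
  proof -
    show "u \<in> borel_measurable borel" by (rule borel_measurable_continuous_onI[OF cu])
    show "p \<in> borel_measurable borel" unfolding p_def by measurable
    have "continuous_on (- {0}) F"
      unfolding F_def by (intro continuous_intros continuous_magnetic_laplacian u2 cu V)
    then show "F \<in> borel_measurable borel" by (rule borel_measurable_punctured)
  qed
  have hR: "(norm x)\<^sup>2 * h x \<le> R\<^sup>2 * h x" for x
    using R[of x] h0[of x] by (cases "norm x \<le> R") (auto simp: h_def intro!: mult_right_mono power_mono)
  have ih: "integrable lborel (\<lambda>x. p x * ((norm x)\<^sup>2 * h x))"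
  proof (rule Bochner_Integration.integrable_bound)
    show "integrable lborel (\<lambda>x. R\<^sup>2 * (p x * h x))" using ip by simp
    show "(\<lambda>x. p x * ((norm x)\<^sup>2 * h x)) \<in> borel_measurable lborel" unfolding h_def by measurable
    show "AE x in lborel. norm (p x * ((norm x)\<^sup>2 * h x)) \<le> norm (R\<^sup>2 * (p x * h x))"
      using hR p0 h0 by (intro AE_I2) (auto simp: abs_mult mult.left_commute intro!: mult_left_mono)
  qed
  then show "integrable lborel (\<lambda>x. norm x powr (2 * \<tau>) * (cmod (u x))\<^sup>2)" by (simp add: ph)
  define e where "e n = inverse (real (Suc n))" for n
  have e: "e n > 0" for n by (simp add: e_def)
  define \<Phi> where "\<Phi> n x = p x * (cutoff0 (e n) x * f x
      - 4 * \<tau> * lam * cutoff0 (e n) x * (norm x)\<^sup>2 * h x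
      - 2 * \<tau> * cutoff1 (e n) x * ((norm x)\<^sup>2 * (F x \<bullet> u x))
      + 2 * \<tau> * (\<tau> * cutoff2 (e n) x + cutoff3 (e n) x / 2) * h x)" for n x
  have \<Phi>: "integrable lborel (\<Phi> n)" "0 \<le> (LINT x|lborel. \<Phi> n x)" for n
    using weighted_inequality_cutoff[OF u2 R V mono less_imp_le[OF tau] e, where lam = lam and R = R]
    unfolding \<Phi>_def p_def f_def h_def F_def by blast+
  \<comment> \<open>The numbers come from \<open>cutoff_bounds_all\<close>: 16 bounds
    \<open>cutoff2\<close>, and 32 is half of 64. In the mixed term the bound 4 on
    \<open>cutoff1\<close> is halved by 2 a b \<le> a^2 + b^2 and multiplied by
    \<open>2 * \<tau>\<close>, giving \<open>4 * \<tau>\<close>.\<close>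
  define B where "B x = p x * f x + 4 * \<tau> * lam * R\<^sup>2 * (p x * h x) + 4 * \<tau> * (p x * f x + p x * h x)
      + 2 * \<tau> * (16 * \<tau> + 32) * (p x * h x)" for x
  have bound: "norm (\<Phi> n x) \<le> B x" for n x
  proof -
    note cb = cutoff_bounds_all[OF e[of n], of x]
    have 1: "\<bar>cutoff0 (e n) x * f x\<bar> \<le> f x"
      using cb(1,2) f0[of x] by (simp add: abs_mult mult_left_le_one_le)
    have "\<bar>cutoff0 (e n) x * ((norm x)\<^sup>2 * h x)\<bar> \<le> (norm x)\<^sup>2 * h x"
      using cb(1,2) h0[of x] by (simp add: abs_mult mult_left_le_one_le)
    then have "\<bar>cutoff0 (e n) x * ((norm x)\<^sup>2 * h x)\<bar> \<le> R\<^sup>2 * h x" using hR[of x] by linarith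
    then have "4 * \<tau> * lam * \<bar>cutoff0 (e n) x * ((norm x)\<^sup>2 * h x)\<bar> \<le> 4 * \<tau> * lam * (R\<^sup>2 * h x)"
      using tau lam by (intro mult_left_mono) auto
    then have 2: "\<bar>4 * \<tau> * lam * cutoff0 (e n) x * (norm x)\<^sup>2 * h x\<bar> \<le> 4 * \<tau> * lam * R\<^sup>2 * h x"
      using tau lam by (simp add: abs_mult mult_ac)
    have "0 \<le> ((norm x)\<^sup>2 * norm (F x) - norm (u x))\<^sup>2" by simp
    also have "\<dots> = f x + h x - 2 * ((norm x)\<^sup>2 * (norm (F x) * norm (u x)))"
      by (simp add: f_def h_def power2_norm_eq_inner[symmetric] power2_eq_square power4_eq_xxxx algebra_simps)
    finally have "2 * ((norm x)\<^sup>2 * (norm (F x) * norm (u x))) \<le> f x + h x" by simp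
    moreover have "(norm x)\<^sup>2 * \<bar>F x \<bullet> u x\<bar> \<le> (norm x)\<^sup>2 * (norm (F x) * norm (u x))"
      by (intro mult_left_mono Cauchy_Schwarz_ineq2) auto
    ultimately have fu: "2 * ((norm x)\<^sup>2 * \<bar>F x \<bullet> u x\<bar>) \<le> f x + h x" by linarith
    have "cutoff1 (e n) x * ((norm x)\<^sup>2 * \<bar>F x \<bullet> u x\<bar>) \<le> 4 * ((norm x)\<^sup>2 * \<bar>F x \<bullet> u x\<bar>)"
      using cb(4) by (intro mult_right_mono) auto
    also have "\<dots> \<le> 2 * (f x + h x)" using mult_left_mono[OF fu, of 2] by simp
    finally have "2 * \<tau> * (cutoff1 (e n) x * ((norm x)\<^sup>2 * \<bar>F x \<bullet> u x\<bar>)) \<le> 2 * \<tau> * (2 * (f x + h x))"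
      using tau by (intro mult_left_mono) auto
    then have 3: "\<bar>2 * \<tau> * cutoff1 (e n) x * ((norm x)\<^sup>2 * (F x \<bullet> u x))\<bar> \<le> 4 * \<tau> * (f x + h x)"
      using tau cb(3) by (simp add: abs_mult mult_ac)
    have "\<bar>\<tau> * cutoff2 (e n) x + cutoff3 (e n) x / 2\<bar> \<le> \<tau> * \<bar>cutoff2 (e n) x\<bar> + \<bar>cutoff3 (e n) x\<bar> / 2"
      using tau by (simp add: abs_mult order_trans[OF abs_triangle_ineq])
    also have "\<dots> \<le> \<tau> * 16 + 64 / 2"
      using cb(5,6) tau by (intro add_mono mult_left_mono divide_right_mono) auto
    finally have "\<bar>\<tau> * cutoff2 (e n) x + cutoff3 (e n) x / 2\<bar> * h x \<le> (16 * \<tau> + 32) * h x"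
      using h0[of x] by (intro mult_right_mono) auto
    then have "2 * \<tau> * (\<bar>\<tau> * cutoff2 (e n) x + cutoff3 (e n) x / 2\<bar> * h x) \<le> 2 * \<tau> * ((16 * \<tau> + 32) * h x)"
      using tau by (intro mult_left_mono) auto
    then have 4: "\<bar>2 * \<tau> * (\<tau> * cutoff2 (e n) x + cutoff3 (e n) x / 2) * h x\<bar> \<le> 2 * \<tau> * (16 * \<tau> + 32) * h x"
      using tau h0[of x] by (simp only: abs_mult abs_of_nonneg mult.assoc)
    let ?Y = "cutoff0 (e n) x * f x - 4 * \<tau> * lam * cutoff0 (e n) x * (norm x)\<^sup>2 * h x
      - 2 * \<tau> * cutoff1 (e n) x * ((norm x)\<^sup>2 * (F x \<bullet> u x))
      + 2 * \<tau> * (\<tau> * cutoff2 (e n) x + cutoff3 (e n) x / 2) * h x"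
    have "\<bar>?Y\<bar> \<le> f x + 4 * \<tau> * lam * R\<^sup>2 * h x + 4 * \<tau> * (f x + h x) + 2 * \<tau> * (16 * \<tau> + 32) * h x"
      using 1 2 3 4 by linarith
    then have "p x * \<bar>?Y\<bar> \<le> p x * (f x + 4 * \<tau> * lam * R\<^sup>2 * h x + 4 * \<tau> * (f x + h x) + 2 * \<tau> * (16 * \<tau> + 32) * h x)"
      using p0(2) by (rule mult_left_mono)
    moreover have "norm (\<Phi> n x) = p x * \<bar>?Y\<bar>"
      unfolding \<Phi>_def real_norm_def abs_mult[of "p x" ?Y] by (simp only: abs_of_nonneg[OF p0(2)])
    ultimately have "norm (\<Phi> n x) \<le> p x * (f x + 4 * \<tau> * lam * R\<^sup>2 * h x + 4 * \<tau> * (f x + h x) + 2 * \<tau> * (16 * \<tau> + 32) * h x)"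
      by simp
    then show ?thesis by (simp add: B_def algebra_simps)
  qed
  define L where "L x = p x * f x - 4 * \<tau> * lam * (p x * ((norm x)\<^sup>2 * h x))" for x
  have iL: "integrable lborel L" unfolding L_def using iF ih by simp
  have "(\<lambda>n. LINT x|lborel. \<Phi> n x) \<longlonglongrightarrow> (LINT x|lborel. L x)"
  proof (rule integral_dominated_convergence[where w = B])
    show "L \<in> borel_measurable lborel" using iL by auto
    show "\<Phi> n \<in> borel_measurable lborel" for n using \<Phi>(1)[of n] by auto
    show "integrable lborel B" unfolding B_def using iF ip by simp
    show "AE x in lborel. norm (\<Phi> n x) \<le> B x" for n using bound by simp
    show "AE x in lborel. (\<lambda>n. \<Phi> n x) \<longlonglongrightarrow> L x"
    proof (rule AE_I2)
      fix x
      show "(\<lambda>n. \<Phi> n x) \<longlonglongrightarrow> L x"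
      proof (cases "x = 0")
        case False
        have "(\<lambda>n. \<Phi> n x) \<longlonglongrightarrow> p x * (1 * f x - 4 * \<tau> * lam * 1 * (norm x)\<^sup>2 * h x
            - 2 * \<tau> * 0 * ((norm x)\<^sup>2 * (F x \<bullet> u x)) + 2 * \<tau> * (\<tau> * 0 + 0 / 2) * h x)"
          unfolding \<Phi>_def e_def by (intro tendsto_intros cutoff_tendsto False) auto
        then show ?thesis by (simp add: L_def algebra_simps)
      qed (simp add: \<Phi>_def L_def p0)
    qed
  qed
  then have "0 \<le> (LINT x|lborel. L x)" by (rule LIMSEQ_le_const) (use \<Phi>(2) in auto)
  also have "(LINT x|lborel. L x) = (LINT x|lborel. p x * f x) - 4 * \<tau> * lam * (LINT x|lborel. p x * ((norm x)\<^sup>2 * h x))"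
    unfolding L_def using iF ih by simp
  finally show "4 * \<tau> * lam * (LINT x|lborel. norm x powr (2 * \<tau>) * (cmod (u x))\<^sup>2)
      \<le> (LINT x|lborel. norm x powr (2 * \<tau> + 2) * (cmod (F x))\<^sup>2)"
    unfolding ph pf by linarith
qed

end

theorem theorem2p4:
  fixes A :: "real ^ 'n::finite \<Rightarrow> real ^ 'n"
    and V :: "real ^ 'n \<Rightarrow> real"
    and \<tau> lam :: real
    and u :: "real ^ 'n \<Rightarrow> complex"
  assumes dim: "CARD('n) \<ge> 3"
    and tau: "\<tau> > 0"
    and lam: "lam > 0"
    and A_reg: "Ck_on 1 (UNIV - {0}) A"
    and V_reg: "\<And>x. x \<noteq> 0 \<Longrightarrow> V differentiable (at x)"
    and B_tau: "\<And>x. x \<noteq> 0 \<Longrightarrow> B_tangential A x = 0"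
    and V_sign: "\<And>v :: real ^ 'n \<Rightarrow> complex.
      \<lbrakk> v \<in> borel_measurable lebesgue;
        \<not> (AE x in lebesgue. v x = 0);
        (\<integral>\<^sup>+x. ennreal (neg_part (radial_deriv (\<lambda>y. norm y * V y) x + V x)
                  * (cmod (v x))\<^sup>2) \<partial>lebesgue) < \<infinity>;
        (\<integral>\<^sup>+x. ennreal (pos_part (radial_deriv (\<lambda>y. norm y * V y) x + V x)
                  * (cmod (v x))\<^sup>2) \<partial>lebesgue) < \<infinity> \<rbrakk>
      \<Longrightarrow> (\<integral>\<^sup>+x. ennreal (neg_part (radial_deriv (\<lambda>y. norm y * V y) x + V x)
                  * (cmod (v x))\<^sup>2) \<partial>lebesgue)
        < (\<integral>\<^sup>+x. ennreal (pos_part (radial_deriv (\<lambda>y. norm y * V y) x + V x)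
                  * (cmod (v x))\<^sup>2) \<partial>lebesgue)"
    and u: "Cinf_compact_support u"
  shows "ennreal (4 * \<tau> * lam)
           * (\<integral>\<^sup>+x. ennreal (norm x powr (2 * \<tau>) * (cmod (u x))\<^sup>2) \<partial>lebesgue)
       \<le> (\<integral>\<^sup>+x. ennreal (norm x powr (2 * \<tau> + 2)
             * (cmod (magnetic_laplacian A u x + of_real (V x) * u x + of_real lam * u x))\<^sup>2)
           \<partial>lebesgue)"
proof (cases "(\<integral>\<^sup>+x. ennreal (norm x powr (2 * \<tau> + 2)
             * (cmod (magnetic_laplacian A u x + of_real (V x) * u x + of_real lam * u x))\<^sup>2)
           \<partial>lborel) < \<infinity>")
  \<comment> \<open>Finiteness provides the integrability needed to remove the cutoff; when the
    right-hand side is infinite there is nothing to prove.\<close>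
  case True
  interpret transversal_field A
    using A_reg B_tau by unfold_locales (simp_all add: Compl_eq_Diff_UNIV)
  let ?F = "\<lambda>x. magnetic_laplacian A u x + of_real (V x) * u x + of_real lam * u x"
  have u2: "Ck_on 2 UNIV u" using u by (simp add: Cinf_compact_support_def)
  have u2': "Ck_on 2 (- {0}) u"
    using u2 by (rule Ck_on_subset) simp
  have "bounded {x. u x \<noteq> 0}"
    using u compact_imp_bounded bounded_subset closure_subset unfolding Cinf_compact_support_def by blast
  then obtain R where "\<And>x. u x \<noteq> 0 \<Longrightarrow> norm x \<le> R" unfolding bounded_iff by auto
  then have R: "\<And>x. norm x > R \<Longrightarrow> u x = 0" by force
  have V: "continuous_on (- {0}) V"
    using V_reg by (auto intro!: differentiable_imp_continuous_on simp: differentiable_on_def differentiable_at_withinI)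
  have "continuous_on (- {0}) ?F"
    by (intro continuous_intros continuous_magnetic_laplacian u2' V Ck_on_continuous[OF Ck_on_2_imp_1[OF u2']])
  then have [measurable]: "?F \<in> borel_measurable borel" by (rule borel_measurable_punctured)
  have F: "integrable lborel (\<lambda>x. norm x powr (2 * \<tau> + 2) * (cmod (?F x))\<^sup>2)"
    using True by (intro integrableI_nonneg) auto
  have d: "real CARD('n) - 2 + 2 * \<tau> > 0" using dim tau by simp
  note c = carleman_inequality[OF u2 R V radial_monotone[OF V_reg V_sign] tau lam d F]
  have "ennreal (4 * \<tau> * lam) * (\<integral>\<^sup>+x. ennreal (norm x powr (2 * \<tau>) * (cmod (u x))\<^sup>2) \<partial>lborel)
      = ennreal (4 * \<tau> * lam * (LINT x|lborel. norm x powr (2 * \<tau>) * (cmod (u x))\<^sup>2))"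
    using tau lam by (subst nn_integral_eq_integral[OF c(1)]) (auto simp: ennreal_mult)
  also have "\<dots> \<le> ennreal (LINT x|lborel. norm x powr (2 * \<tau> + 2) * (cmod (?F x))\<^sup>2)"
    by (rule ennreal_leI[OF c(2)])
  also have "\<dots> = (\<integral>\<^sup>+x. ennreal (norm x powr (2 * \<tau> + 2) * (cmod (?F x))\<^sup>2) \<partial>lborel)"
    by (rule nn_integral_eq_integral[OF F, symmetric]) auto
  finally show ?thesis by (simp only: nn_integral_completion)
next
  case False
  then show ?thesis by (simp add: nn_integral_completion not_less top_unique)
qed

end
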